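(* Let $X$ be a d-space, $X_1,X_2\subseteq X$ with $X=\mathrm{Int}(X_1)\cup\mathrm{Int}(X_2)$, the dipaths of $X$ being the finite concatenations of dipaths of $X_1$ and $X_2$, and $X_0=X_1\cap X_2$. For $k=0,1,2$ let $X_k=X_{k,0}\supseteq X_{k,1}\supseteq\dots\supseteq X_{k,n}$ with functors $P_{k,\ell}:\vec\pi_1(X_k,X_{k,\ell-1})\to\vec\pi_1(X_k,X_{k,\ell})$ ($1\le\ell\le n$) be compatible chains of future retracts and past retracts. Put $X_\ell:=X_{1,\ell}\cup X_{2,\ell}$ (so $X_0$-level is $X$). Then for each $\ell$ the square formed by $\vec\pi_1(X_0,X_{0,\ell})$, $\vec\pi_1(X_1,X_{1,\ell})$, $\vec\pi_1(X_2,X_{2,\ell})$, $\vec\pi_1(X,X_\ell)$ and the inclusion-induced functors is a pushout of categories; there is a unique functor $P_\ell:\vec\pi_1(X,X_{\ell-1})\to\vec\pi_1(X,X_\ell)$ with $P_\ell\circ j_{k,\ell-1}=j_{k,\ell}\circ P_{k,\ell}$ for $k=1,2$ (where $j_{k,m}:\vec\pi_1(X_k,X_{k,m})\to\vec\pi_1(X,X_m)$ is induced by inclusion); and $P_\ell$ is a future retract if the $P_{k,\ell}$ are future retracts and a past retract if they are past retracts. Hence the pushout $\vec\pi_1(X)\xrightarrow{P_1}\vec\pi_1(X,X_1)\xrightarrow{P_2}\dots\xrightarrow{P_n}\vec\pi_1(X,X_n)$ is a chain of future retracts and past retracts.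
   Context: A d-space is a topological space with a set of continuous paths $[0,1]\to X$ (dipaths) containing all constant paths, closed under precomposition with continuous non-decreasing maps $[0,1]\to[0,1]$ and under concatenation; subsets carry the dipaths with image in them. The fundamental category $\vec\pi_1(X)$ has objects the points of $X$ and morphisms $a\to b$ the classes of dipaths from $a$ to $b$ modulo the equivalence relation generated by endpoint-fixing directed homotopies; composition is concatenation. For $A\subseteq X$, $\vec\pi_1(X,A)$ is the full subcategory on objects in $A$; inclusions induce functors. For $A\subseteq B\subseteq X$ with inclusion $\iota:\vec\pi_1(X,A)\to\vec\pi_1(X,B)$, a future retract is a functor $P:\vec\pi_1(X,B)\to\vec\pi_1(X,A)$ left adjoint to $\iota$ whose unit satisfies $\eta_a=\mathrm{id}_a$ for $a\in A$; a past retract is a functor $P$ right adjoint to $\iota$ whose counit satisfies $\varepsilon_a=\mathrm{id}_a$ for $a\in A$. Compatible chains: for each $\ell\in\{1,\dots,n\}$ the three functors $P_{0,\ell},P_{1,\ell},P_{2,\ell}$ are either all future retracts or all past retracts; $X_{0,\ell}=X_{1,\ell}\cap X_{2,\ell}$; $X_\ell=X_{1,\ell}\cup X_{2,\ell}$ satisfies $X_\ell=\mathrm{Int}_{X_\ell}(X_{1,\ell})\cup\mathrm{Int}_{X_\ell}(X_{2,\ell})$; with $i_{k,m}:\vec\pi_1(X_0,X_{0,m})\to\vec\pi_1(X_k,X_{k,m})$ the inclusion-induced functors ($k=1,2$), one has $P_{k,\ell}\circ i_{k,\ell-1}=i_{k,\ell}\circ P_{0,\ell}$; and for every $x\in X_{0,\ell-1}$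 the unit (resp. counit) of $P_{0,\ell}$ at $x$ maps to the unit (resp. counit) of $P_{k,\ell}$ at $x$ under the functor $\vec\pi_1(X_0)\to\vec\pi_1(X_k)$, $k=1,2$. *)

theory Defs
  imports "HOL-Analysis.Analysis"
begin

text \<open>A d-space is a subset X of a topological space (with the subspace topology)
  together with a set D of dipaths, paths being maps real => 'a continuous on [0,1].\<close>

definition d_space :: "'a::topological_space set \<Rightarrow> (real \<Rightarrow> 'a) set \<Rightarrow> bool" where
  "d_space X D \<longleftrightarrow>
     (\<forall>p\<in>D. continuous_on {0..1} p \<and> p ` {0..1} \<subseteq> X) \<and>
     (\<forall>x\<in>X. (\<lambda>t. x) \<in> D) \<and>
     (\<forall>p\<in>D. \<forall>\<phi>. continuous_on {0..1} \<phi> \<and> \<phi> ` {0..1} \<subseteq> {0..1} \<and> mono_on {0..1} \<phi>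
                 \<longrightarrow> p \<circ> \<phi> \<in> D) \<and>
     (\<forall>p\<in>D. \<forall>q\<in>D. p 1 = q 0 \<longrightarrow> p +++ q \<in> D)"

definition dsub :: "(real \<Rightarrow> 'a) set \<Rightarrow> 'a set \<Rightarrow> (real \<Rightarrow> 'a) set" where
  "dsub D Y = {p \<in> D. p ` {0..1} \<subseteq> Y}"

definition sq_dipath :: "(real \<Rightarrow> real \<times> real) \<Rightarrow> bool" where
  "sq_dipath \<gamma> \<longleftrightarrow> continuous_on {0..1} \<gamma> \<and> \<gamma> ` {0..1} \<subseteq> {0..1} \<times> {0..1} \<and>
     mono_on {0..1} (fst \<circ> \<gamma>) \<and> mono_on {0..1} (snd \<circ> \<gamma>)"

definition dihtpy :: "'a::topological_space set \<Rightarrow> (real \<Rightarrow> 'a) set \<Rightarrow> (real \<Rightarrow> 'a) \<Rightarrow> (real \<Rightarrow> 'a) \<Rightarrow> bool" where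
  "dihtpy X D p q \<longleftrightarrow> (\<exists>H :: real \<times> real \<Rightarrow> 'a.
     continuous_on ({0..1} \<times> {0..1}) H \<and> H ` ({0..1} \<times> {0..1}) \<subseteq> X \<and>
     (\<forall>\<gamma>. sq_dipath \<gamma> \<longrightarrow> H \<circ> \<gamma> \<in> D) \<and>
     (\<forall>t\<in>{0..1}. H (0, t) = p t \<and> H (1, t) = q t) \<and>
     (\<forall>s\<in>{0..1}. H (s, 0) = p 0 \<and> H (s, 1) = p 1))"

definition direl :: "'a::topological_space set \<Rightarrow> (real \<Rightarrow> 'a) set \<Rightarrow> ((real \<Rightarrow> 'a) \<times> (real \<Rightarrow> 'a)) set" where
  "direl X D = (let R = {(p, q). p \<in> D \<and> q \<in> D \<and> dihtpy X D p q}
                in {(p, q). p \<in> D \<and> q \<in> D \<and> (p, q) \<in> (R \<union> R\<inverse>)\<^sup>*})"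

definition dclass :: "'a::topological_space set \<Rightarrow> (real \<Rightarrow> 'a) set \<Rightarrow> (real \<Rightarrow> 'a) \<Rightarrow> (real \<Rightarrow> 'a) set" where
  "dclass X D p = {q. (p, q) \<in> direl X D}"

record ('o, 'm) cat =
  Obj :: "'o set"
  Mor :: "'m set"
  Dom :: "'m \<Rightarrow> 'o"
  Cod :: "'m \<Rightarrow> 'o"
  Id :: "'o \<Rightarrow> 'm"
  Comp :: "'m \<Rightarrow> 'm \<Rightarrow> 'm"   \<comment> \<open>Comp g f = g after f\<close>

definition hom :: "('o, 'm, 'x) cat_scheme \<Rightarrow> 'o \<Rightarrow> 'o \<Rightarrow> 'm set" where
  "hom C x y = {f \<in> Mor C. Dom C f = x \<and> Cod C f = y}"

definition category :: "('o, 'm, 'x) cat_scheme \<Rightarrow> bool" where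
  "category C \<longleftrightarrow>
     (\<forall>f\<in>Mor C. Dom C f \<in> Obj C \<and> Cod C f \<in> Obj C) \<and>
     (\<forall>x\<in>Obj C. Id C x \<in> hom C x x) \<and>
     (\<forall>f\<in>Mor C. \<forall>g\<in>Mor C. Cod C f = Dom C g \<longrightarrow> Comp C g f \<in> hom C (Dom C f) (Cod C g)) \<and>
     (\<forall>f\<in>Mor C. Comp C f (Id C (Dom C f)) = f \<and> Comp C (Id C (Cod C f)) f = f) \<and>
     (\<forall>f\<in>Mor C. \<forall>g\<in>Mor C. \<forall>h\<in>Mor C. Cod C f = Dom C g \<and> Cod C g = Dom C h \<longrightarrow>
        Comp C h (Comp C g f) = Comp C (Comp C h g) f)"

type_synonym ('o1, 'm1, 'o2, 'm2) ftr = "('o1 \<Rightarrow> 'o2) \<times> ('m1 \<Rightarrow> 'm2)"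

definition is_functor :: "('o1, 'm1, 'x) cat_scheme \<Rightarrow> ('o2, 'm2, 'y) cat_scheme \<Rightarrow> ('o1, 'm1, 'o2, 'm2) ftr \<Rightarrow> bool" where
  "is_functor C E F \<longleftrightarrow>
     (\<forall>x\<in>Obj C. fst F x \<in> Obj E) \<and>
     (\<forall>f\<in>Mor C. snd F f \<in> hom E (fst F (Dom C f)) (fst F (Cod C f))) \<and>
     (\<forall>x\<in>Obj C. snd F (Id C x) = Id E (fst F x)) \<and>
     (\<forall>f\<in>Mor C. \<forall>g\<in>Mor C. Cod C f = Dom C g \<longrightarrow> snd F (Comp C g f) = Comp E (snd F g) (snd F f))"

definition fcomp :: "('o2, 'm2, 'o3, 'm3) ftr \<Rightarrow> ('o1, 'm1, 'o2, 'm2) ftr \<Rightarrow> ('o1, 'm1, 'o3, 'm3) ftr"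
  (infixl \<open>\<circ>\<^sub>F\<close> 55) where
  "G \<circ>\<^sub>F F = (fst G \<circ> fst F, snd G \<circ> snd F)"

definition fun_eq_on :: "('o1, 'm1, 'x) cat_scheme \<Rightarrow> ('o1, 'm1, 'o2, 'm2) ftr \<Rightarrow> ('o1, 'm1, 'o2, 'm2) ftr \<Rightarrow> bool" where
  "fun_eq_on C F G \<longleftrightarrow> (\<forall>x\<in>Obj C. fst F x = fst G x) \<and> (\<forall>f\<in>Mor C. snd F f = snd G f)"

text \<open>Pushout of categories: commutative square C0 -> C1, C2 -> C, universal among all
  cocones into categories whose objects/morphisms live in the types of the given itself-argument
  (in a theorem these type variables are arbitrary, giving the universal property for every
  category).\<close>
definition is_pushout ::
  "('oe, 'me) cat itself \<Rightarrow> ('o0, 'm0, 'x0) cat_scheme \<Rightarrow> ('o1, 'm1, 'x1) cat_scheme \<Rightarrow> ('o2, 'm2, 'x2) cat_scheme \<Rightarrow> ('o, 'm, 'x) cat_scheme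
   \<Rightarrow> ('o0, 'm0, 'o1, 'm1) ftr \<Rightarrow> ('o0, 'm0, 'o2, 'm2) ftr
   \<Rightarrow> ('o1, 'm1, 'o, 'm) ftr \<Rightarrow> ('o2, 'm2, 'o, 'm) ftr \<Rightarrow> bool" where
  "is_pushout T C0 C1 C2 C F1 F2 G1 G2 \<longleftrightarrow>
     category C0 \<and> category C1 \<and> category C2 \<and> category C \<and>
     is_functor C0 C1 F1 \<and> is_functor C0 C2 F2 \<and> is_functor C1 C G1 \<and> is_functor C2 C G2 \<and>
     fun_eq_on C0 (G1 \<circ>\<^sub>F F1) (G2 \<circ>\<^sub>F F2) \<and>
     (\<forall>(E :: ('oe, 'me) cat) H1 H2.
        category E \<and> is_functor C1 E H1 \<and> is_functor C2 E H2 \<and> fun_eq_on C0 (H1 \<circ>\<^sub>F F1) (H2 \<circ>\<^sub>F F2) \<longrightarrow>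
        (\<exists>H. is_functor C E H \<and> fun_eq_on C1 (H \<circ>\<^sub>F G1) H1 \<and> fun_eq_on C2 (H \<circ>\<^sub>F G2) H2 \<and>
             (\<forall>H'. is_functor C E H' \<and> fun_eq_on C1 (H' \<circ>\<^sub>F G1) H1 \<and> fun_eq_on C2 (H' \<circ>\<^sub>F G2) H2
                   \<longrightarrow> fun_eq_on C H H')))"

type_synonym 'a dmor = "'a \<times> 'a \<times> (real \<Rightarrow> 'a) set"

definition rep :: "(real \<Rightarrow> 'a) set \<Rightarrow> real \<Rightarrow> 'a" where
  "rep C = (SOME p. p \<in> C)"

definition fund_cat :: "'a::topological_space set \<Rightarrow> (real \<Rightarrow> 'a) set \<Rightarrow> 'a set \<Rightarrow> ('a, 'a dmor) cat" where
  "fund_cat X D A = \<lparr>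
     Obj = A,
     Mor = {(a, b, dclass X D p) | a b p. a \<in> A \<and> b \<in> A \<and> p \<in> D \<and> p 0 = a \<and> p 1 = b},
     Dom = (\<lambda>f. fst f),
     Cod = (\<lambda>f. fst (snd f)),
     Id = (\<lambda>a. (a, a, dclass X D (\<lambda>t. a))),
     Comp = (\<lambda>g f. (fst f, fst (snd g), dclass X D (rep (snd (snd f)) +++ rep (snd (snd g)))))\<rparr>"

definition fc :: "(real \<Rightarrow> 'a::topological_space) set \<Rightarrow> 'a set \<Rightarrow> 'a set \<Rightarrow> ('a, 'a dmor) cat" where
  "fc D Y A = fund_cat Y (dsub D Y) A"

definition incl :: "(real \<Rightarrow> 'a::topological_space) set \<Rightarrow> 'a set \<Rightarrow> ('a, 'a dmor, 'a, 'a dmor) ftr" where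
  "incl D Z = (\<lambda>x. x, \<lambda>f. (fst f, fst (snd f), dclass Z (dsub D Z) (rep (snd (snd f)))))"

text \<open>CA is the full subcategory of CB on a subset of objects (inclusion iota acts as identity
  on morphism triples). P : CB -> CA is a future retract with unit eta: P is left adjoint to
  the inclusion, with unit eta (natural, universal), and eta a = id for a in CA.\<close>
definition future_retract :: "('o, 'm) cat \<Rightarrow> ('o, 'm) cat \<Rightarrow> ('o, 'm, 'o, 'm) ftr \<Rightarrow> ('o \<Rightarrow> 'm) \<Rightarrow> bool" where
  "future_retract CB CA P \<eta> \<longleftrightarrow>
     is_functor CB CA P \<and>
     (\<forall>b\<in>Obj CB. \<eta> b \<in> hom CB b (fst P b)) \<and>
     (\<forall>f\<in>Mor CB. Comp CB (snd P f) (\<eta> (Dom CB f)) = Comp CB (\<eta> (Cod CB f)) f) \<and>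
     (\<forall>b\<in>Obj CB. \<forall>a\<in>Obj CA. \<forall>f\<in>hom CB b a. \<exists>!g. g \<in> hom CA (fst P b) a \<and> Comp CB g (\<eta> b) = f) \<and>
     (\<forall>a\<in>Obj CA. \<eta> a = Id CB a)"

definition past_retract :: "('o, 'm) cat \<Rightarrow> ('o, 'm) cat \<Rightarrow> ('o, 'm, 'o, 'm) ftr \<Rightarrow> ('o \<Rightarrow> 'm) \<Rightarrow> bool" where
  "past_retract CB CA P \<epsilon> \<longleftrightarrow>
     is_functor CB CA P \<and>
     (\<forall>b\<in>Obj CB. \<epsilon> b \<in> hom CB (fst P b) b) \<and>
     (\<forall>f\<in>Mor CB. Comp CB f (\<epsilon> (Dom CB f)) = Comp CB (\<epsilon> (Cod CB f)) (snd P f)) \<and>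
     (\<forall>b\<in>Obj CB. \<forall>a\<in>Obj CA. \<forall>f\<in>hom CB a b. \<exists>!g. g \<in> hom CA a (fst P b) \<and> Comp CB (\<epsilon> b) g = f) \<and>
     (\<forall>a\<in>Obj CA. \<epsilon> a = Id CB a)"

definition retract :: "bool \<Rightarrow> ('o, 'm) cat \<Rightarrow> ('o, 'm) cat \<Rightarrow> ('o, 'm, 'o, 'm) ftr \<Rightarrow> ('o \<Rightarrow> 'm) \<Rightarrow> bool" where
  "retract fut CB CA P u = (if fut then future_retract CB CA P u else past_retract CB CA P u)"

end

theory Submission
  imports Defs
begin

text \<open>A functor out of the fundamental category of \<open>X\<close> is determined on a dipath by cutting it into
  pieces inside \<open>X1\<close> or \<open>X2\<close>, and the resulting composite is invariant under directed homotopy because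
  a directed square can be cut into small squares, each of which commutes in one of the two parts:
  any two monotone paths in a square with the same endpoints are dihomotopic. This is van Kampen's
  theorem with all points as base points. The levels of the chains are then reached by induction.
  A future or past retract restricts to the identity on its subcategory, so the square at level
  \<open>l\<close> is a retract of the square at level \<open>l - 1\<close>, and a retract of a pushout is a pushout. The units
  of the given retracts glue; the result is natural since it is natural on generators.\<close>

section \<open>Dipaths and their homotopy classes\<close>

text \<open>Naturality on generators does not yet make the glued unit universal: a morphism from
  \<open>b\<close> into the subcategory may leave the part that contains \<open>b\<close>, so the
  universal properties of the parts do not apply to it directly. What does pass from the parts to
  the whole is the equation that \<open>Q\<close> sends the unit at \<open>b\<close> to an identity;
  together with naturality it forces unique factorization. Besides the pushout property, two facts
  travel along the induction: the morphisms coming from the two parts generate, and the pushout is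
  universal for targets of the type of the fundamental categories themselves, since \<open>Q\<close>
  is obtained as a functor into the next level. Subdivisions are never chosen, bisection taking the
  place of Lebesgue numbers. Paths stay total functions on the reals, whence the care with values
  outside the unit interval.\<close>

lemma d_space_continuous: "d_space X D \<Longrightarrow> p \<in> D \<Longrightarrow> continuous_on {0..1} p"
  and d_space_image: "d_space X D \<Longrightarrow> p \<in> D \<Longrightarrow> p ` {0..1} \<subseteq> X"
  and d_space_const: "d_space X D \<Longrightarrow> x \<in> X \<Longrightarrow> (\<lambda>t. x) \<in> D"
  and d_space_join: "d_space X D \<Longrightarrow> p \<in> D \<Longrightarrow> q \<in> D \<Longrightarrow> p 1 = q 0 \<Longrightarrow> p +++ q \<in> D"
  unfolding d_space_def by blast+

lemma d_space_reparam:
  assumes "d_space X D" "p \<in> D" "continuous_on {0..1} \<phi>" "\<phi> ` {0..1} \<subseteq> {0..1}" "mono_on {0..1} \<phi>"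
  shows "p \<circ> \<phi> \<in> D"
  using assms unfolding d_space_def by blast

lemma d_space_endpoints:
  assumes "d_space X D" "p \<in> D" shows "p 0 \<in> X" "p 1 \<in> X"
  using d_space_image[OF assms] by auto

lemma join_0 [simp]: "(p +++ q) 0 = p 0" and join_1 [simp]: "(p +++ q) 1 = q 1"
  by (simp_all add: joinpaths_def)

lemma d_space_dsub:
  assumes "d_space X D" "Y \<subseteq> X"
  shows "d_space Y (dsub D Y)"
proof -
  have "p +++ q \<in> dsub D Y" if "p \<in> dsub D Y" "q \<in> dsub D Y" "p 1 = q 0" for p q
  proof -
    have "(p +++ q) ` {0..1} \<subseteq> Y"
      using that unfolding dsub_def joinpaths_def by (auto simp: image_subset_iff)
    thus ?thesis using that d_space_join[OF assms(1)] unfolding dsub_def by auto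
  qed
  moreover have "p \<circ> \<phi> \<in> dsub D Y"
    if "p \<in> dsub D Y" "continuous_on {0..1} \<phi>" "\<phi> ` {0..1} \<subseteq> {0..1}" "mono_on {0..1} \<phi>" for p \<phi>
    using that d_space_reparam[OF assms(1), of p \<phi>] unfolding dsub_def by (auto simp: image_subset_iff)
  ultimately show ?thesis
    using assms unfolding d_space_def by (auto simp: dsub_def)
qed

lemma dsub_whole: "d_space X D \<Longrightarrow> dsub D X = D"
  unfolding dsub_def d_space_def by blast

lemma mono_on_scale: "0 \<le> (c::real) \<Longrightarrow> mono_on S (\<lambda>x::real. c * x + d)"
  by (auto intro!: mono_onI mult_left_mono)

definition subdipath :: "real \<Rightarrow> real \<Rightarrow> (real \<Rightarrow> 'a) \<Rightarrow> real \<Rightarrow> 'a" where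
  "subdipath a b p = (\<lambda>t. p ((b - a) * t + a))"

lemma subdipath_trivial [simp]: "subdipath 0 1 p = p"
  by (simp add: subdipath_def)

lemma subdipath_in_d_space:
  assumes "d_space X D" "p \<in> D" "0 \<le> a" "a \<le> b" "b \<le> 1"
  shows "subdipath a b p \<in> D"
proof -
  have "(\<lambda>t. (b - a) * t + a) ` {0..1} \<subseteq> {0..1}"
  proof clarsimp
    fix t :: real assume "0 \<le> t" "t \<le> 1"
    hence "0 \<le> (b - a) * t" "(b - a) * t \<le> b - a"
      using assms mult_left_le[of t "b - a"] by auto
    thus "0 \<le> (b - a) * t + a \<and> (b - a) * t + a \<le> 1" using assms by auto
  qed
  hence "p \<circ> (\<lambda>t. (b - a) * t + a) \<in> D"
    using assms by (intro d_space_reparam[OF assms(1,2)]) (auto intro!: continuous_intros mono_on_scale)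
  thus ?thesis by (simp add: subdipath_def o_def)
qed

lemma subdipath_image_interval:
  assumes "a \<le> b" shows "subdipath a b p ` {0..1} = p ` {a..b}"
proof -
  have "subdipath a b p ` {0..1} = p ` ((\<lambda>t. (b - a) * t + a) ` {0..1})"
    by (simp add: subdipath_def image_image)
  also have "(\<lambda>t. (b - a) * t + a) ` {0..1} = {a..b}"
    using assms by (subst image_affinity_atLeastAtMost) auto
  finally show ?thesis .
qed

lemma dihtpy_endpoints: "dihtpy X D p q \<Longrightarrow> q 0 = p 0 \<and> q 1 = p 1"
  unfolding dihtpy_def by (metis atLeastAtMost_iff order_refl zero_le_one)

lemma direl_refl: "p \<in> D \<Longrightarrow> (p, p) \<in> direl X D"
  by (auto simp: direl_def Let_def)

lemma direl_sym: "(p, q) \<in> direl X D \<Longrightarrow> (q, p) \<in> direl X D"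
proof -
  let ?R = "{(p, q). p \<in> D \<and> q \<in> D \<and> dihtpy X D p q}"
  assume "(p, q) \<in> direl X D"
  hence "p \<in> D" "q \<in> D" "(p, q) \<in> (?R \<union> ?R\<inverse>)\<^sup>*" by (auto simp: direl_def Let_def)
  moreover have "sym ((?R \<union> ?R\<inverse>)\<^sup>*)" by (intro sym_rtrancl sym_Un_converse)
  ultimately show ?thesis by (auto simp: direl_def Let_def dest: symD)
qed

lemma direl_trans: "(p, q) \<in> direl X D \<Longrightarrow> (q, r) \<in> direl X D \<Longrightarrow> (p, r) \<in> direl X D"
  by (auto simp: direl_def Let_def)

lemma direl_dihtpy: "p \<in> D \<Longrightarrow> q \<in> D \<Longrightarrow> dihtpy X D p q \<Longrightarrow> (p, q) \<in> direl X D"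
  by (auto simp: direl_def Let_def)

lemma direl_mem: "(p, q) \<in> direl X D \<Longrightarrow> p \<in> D \<and> q \<in> D"
  by (auto simp: direl_def Let_def)

text \<open>The closure contains the converse of the homotopy relation, so zigzags reduce to a
  single directed homotopy as soon as the property is reflexive on \<open>D\<close>, symmetric and
  transitive.\<close>

lemma direl_induct [consumes 1, case_names dihtpy refl sym trans]:
  assumes "(p, q) \<in> direl X D"
    and base: "\<And>r s. r \<in> D \<Longrightarrow> s \<in> D \<Longrightarrow> dihtpy X D r s \<Longrightarrow> S r s"
    and refl: "\<And>r. r \<in> D \<Longrightarrow> S r r"
    and sym: "\<And>r s. S r s \<Longrightarrow> S s r"
    and trans: "\<And>r s t. S r s \<Longrightarrow> S s t \<Longrightarrow> S r t"
  shows "S p q"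
proof -
  let ?R = "{(p, q). p \<in> D \<and> q \<in> D \<and> dihtpy X D p q}"
  have "p \<in> D" "(p, q) \<in> (?R \<union> ?R\<inverse>)\<^sup>*" using assms(1) by (auto simp: direl_def Let_def)
  from this(2,1) show ?thesis
  proof (induction rule: rtrancl_induct)
    case base thus ?case by (rule refl)
  next
    case (step y z)
    have "S y z" using step.hyps(2) assms(2) sym by auto
    thus ?case using step trans by blast
  qed
qed

lemma direl_endpoints: "(p, q) \<in> direl X D \<Longrightarrow> p 0 = q 0 \<and> p 1 = q 1"
  by (induction rule: direl_induct) (auto dest: dihtpy_endpoints)

lemma dclass_eqI: "(p, q) \<in> direl X D \<Longrightarrow> dclass X D p = dclass X D q"
  unfolding dclass_def by (blast intro: direl_trans direl_sym)

lemma rep_dclass: "p \<in> D \<Longrightarrow> (p, rep (dclass X D p)) \<in> direl X D"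
  unfolding rep_def dclass_def mem_Collect_eq by (rule someI[of "\<lambda>q. (p, q) \<in> direl X D" p]) (rule direl_refl)

subsection \<open>Directed squares\<close>

text \<open>This is \<open>dihtpy\<close> without its boundary conditions. Squares with arbitrary
  edges arise when a homotopy is subdivided, since small rectangles do not have constant
  sides.\<close>

definition dsquare :: "'a::topological_space set \<Rightarrow> (real \<Rightarrow> 'a) set \<Rightarrow> (real \<times> real \<Rightarrow> 'a) \<Rightarrow> bool" where
  "dsquare X D H \<longleftrightarrow> continuous_on ({0..1} \<times> {0..1}) H \<and> H ` ({0..1} \<times> {0..1}) \<subseteq> X \<and>
     (\<forall>\<gamma>. sq_dipath \<gamma> \<longrightarrow> H \<circ> \<gamma> \<in> D)"

lemma dihtpy_iff_dsquare:
  "dihtpy X D p q \<longleftrightarrow> (\<exists>H. dsquare X D H \<and> (\<forall>t\<in>{0..1}. H (0, t) = p t \<and> H (1, t) = q t) \<and>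
     (\<forall>s\<in>{0..1}. H (s, 0) = p 0 \<and> H (s, 1) = p 1))"
  unfolding dihtpy_def dsquare_def by (simp add: conj_assoc)

lemma sq_dipathI:
  assumes "continuous_on {0..1} f" "continuous_on {0..1} g"
    "\<And>t. t \<in> {0..1} \<Longrightarrow> f t \<in> {0..1} \<and> g t \<in> {0..1}"
    "\<And>s t. 0 \<le> s \<Longrightarrow> s \<le> t \<Longrightarrow> t \<le> 1 \<Longrightarrow> f s \<le> f t \<and> g s \<le> g t"
  shows "sq_dipath (\<lambda>t. (f t, g t))"
  using assms unfolding sq_dipath_def
  by (auto intro!: continuous_intros mono_onI simp: o_def)

lemma sq_dipathD:
  assumes "sq_dipath \<gamma>"
  shows "continuous_on {0..1} (\<lambda>t. fst (\<gamma> t))" "continuous_on {0..1} (\<lambda>t. snd (\<gamma> t))"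
    "\<And>t. t \<in> {0..1} \<Longrightarrow> fst (\<gamma> t) \<in> {0..1} \<and> snd (\<gamma> t) \<in> {0..1}"
    "\<And>s t. 0 \<le> s \<Longrightarrow> s \<le> t \<Longrightarrow> t \<le> 1 \<Longrightarrow> fst (\<gamma> s) \<le> fst (\<gamma> t) \<and> snd (\<gamma> s) \<le> snd (\<gamma> t)"
proof -
  have c: "continuous_on {0..1} \<gamma>" and im: "\<gamma> ` {0..1} \<subseteq> {0..1} \<times> {0..1}"
    and m: "mono_on {0..1} (fst \<circ> \<gamma>)" "mono_on {0..1} (snd \<circ> \<gamma>)"
    using assms by (auto simp: sq_dipath_def)
  show "continuous_on {0..1} (\<lambda>t. fst (\<gamma> t))" "continuous_on {0..1} (\<lambda>t. snd (\<gamma> t))"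
    using c by (auto intro: continuous_intros)
  show "fst (\<gamma> t) \<in> {0..1} \<and> snd (\<gamma> t) \<in> {0..1}" if "t \<in> {0..1}" for t
    using im that by (metis image_subset_iff mem_Times_iff)
  show "fst (\<gamma> s) \<le> fst (\<gamma> t) \<and> snd (\<gamma> s) \<le> snd (\<gamma> t)" if "0 \<le> s" "s \<le> t" "t \<le> 1" for s t
    using m that by (auto simp: mono_on_def)
qed

text \<open>A map that is monotone for the product order carries monotone paths of the square to
  monotone paths. Rescaling, transposition and interpolation between paths are all of this
  kind.\<close>

lemma dsquare_comp:
  assumes H: "dsquare X D H"
    and "continuous_on ({0..1} \<times> {0..1}) \<Phi>" "\<Phi> ` ({0..1} \<times> {0..1}) \<subseteq> {0..1} \<times> {0..1}"
    and mono: "\<And>x y. x \<in> {0..1} \<times> {0..1} \<Longrightarrow> y \<in> {0..1} \<times> {0..1} \<Longrightarrow> fst x \<le> fst y \<Longrightarrow> snd x \<le> snd y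
       \<Longrightarrow> fst (\<Phi> x) \<le> fst (\<Phi> y) \<and> snd (\<Phi> x) \<le> snd (\<Phi> y)"
  shows "dsquare X D (H \<circ> \<Phi>)"
proof -
  have "sq_dipath (\<Phi> \<circ> \<gamma>)" if g: "sq_dipath \<gamma>" for \<gamma>
  proof -
    have im: "\<gamma> ` {0..1} \<subseteq> {0..1} \<times> {0..1}" and c: "continuous_on {0..1} \<gamma>"
      using g unfolding sq_dipath_def by auto
    have "continuous_on {0..1} (\<Phi> \<circ> \<gamma>)"
      using c assms(2) im continuous_on_compose continuous_on_subset by blast
    moreover have "(\<Phi> \<circ> \<gamma>) ` {0..1} \<subseteq> {0..1} \<times> {0..1}"
      using im assms(3) by (fastforce simp: image_subset_iff)
    moreover have "fst (\<Phi> (\<gamma> s)) \<le> fst (\<Phi> (\<gamma> t)) \<and> snd (\<Phi> (\<gamma> s)) \<le> snd (\<Phi> (\<gamma> t))"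
      if "0 \<le> s" "s \<le> t" "t \<le> 1" for s t
    proof (rule mono)
      show "\<gamma> s \<in> {0..1} \<times> {0..1}" "\<gamma> t \<in> {0..1} \<times> {0..1}"
        using im that by (simp_all add: image_subset_iff)
    qed (use sq_dipathD(4)[OF g that] in auto)
    ultimately show ?thesis unfolding sq_dipath_def by (auto intro!: mono_onI)
  qed
  moreover have "continuous_on ({0..1} \<times> {0..1}) (H \<circ> \<Phi>)"
    using assms unfolding dsquare_def by (meson continuous_on_compose continuous_on_subset)
  moreover have "(H \<circ> \<Phi>) ` ({0..1} \<times> {0..1}) \<subseteq> X"
  proof -
    have "H ` (\<Phi> ` ({0..1} \<times> {0..1})) \<subseteq> X"
      using assms(3) H unfolding dsquare_def by (meson image_mono order_trans)
    thus ?thesis by (simp add: image_comp)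
  qed
  ultimately show ?thesis
    using H unfolding dsquare_def by (auto simp: o_assoc[symmetric])
qed

text \<open>Pulled back along a projection, a dipath becomes a square that is constant in the other
  variable. Facts about reparametrizations thereby become facts about monotone paths in a
  square.\<close>

lemma dsquare_fst:
  assumes X: "d_space X D" and "p \<in> D"
  shows "dsquare X D (p \<circ> fst)"
proof -
  have "p \<circ> fst \<circ> \<gamma> \<in> D" if g: "sq_dipath \<gamma>" for \<gamma>
    unfolding o_assoc[symmetric]
    using sq_dipathD[OF g] by (intro d_space_reparam[OF assms]) (auto intro!: mono_onI simp: o_def)
  moreover have "continuous_on ({0..1} \<times> {0..1}) (p \<circ> fst)"
    by (intro continuous_on_compose continuous_intros
          continuous_on_subset[OF d_space_continuous[OF assms]]) auto
  ultimately show ?thesis using d_space_image[OF assms] unfolding dsquare_def by auto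
qed

lemma dsquare_snd:
  assumes X: "d_space X D" and "p \<in> D"
  shows "dsquare X D (p \<circ> snd)"
proof -
  have "dsquare X D (p \<circ> fst \<circ> (\<lambda>x. (snd x, fst x)))"
    by (rule dsquare_comp[OF dsquare_fst[OF assms]]) (auto intro!: continuous_intros)
  thus ?thesis by (simp add: o_def)
qed

text \<open>For fixed weights the value grows with both points; growth in \<open>s\<close> rests on
  \<open>a \<le> b\<close>, which is where comparability of two paths enters later on.\<close>

lemma convex_combination_mono:
  fixes a b a' b' s s' :: real
  assumes "a \<le> b" "a \<le> a'" "b \<le> b'" "s \<le> s'" "0 \<le> s'" "s' \<le> 1"
  shows "(1 - s) * a + s * b \<le> (1 - s') * a' + s' * b'"
proof -
  have "(1 - s) * a + s * b = a + s * (b - a)" by (simp add: algebra_simps)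
  also have "\<dots> \<le> a + s' * (b - a)" using assms by (intro add_left_mono mult_right_mono) auto
  also have "\<dots> = (1 - s') * a + s' * b" by (simp add: algebra_simps)
  also have "\<dots> \<le> (1 - s') * a' + s' * b'" using assms by (intro add_mono mult_left_mono) auto
  finally show ?thesis .
qed

text \<open>The straight line homotopy between the two paths is a monotone self-map of the square,
  because moving from \<open>\<alpha>\<close> to \<open>\<beta>\<close> increases both coordinates.
  Composing \<open>H\<close> with it gives the directed homotopy.\<close>

lemma dsquare_paths_le:
  assumes H: "dsquare X D H" and a: "sq_dipath \<alpha>" and b: "sq_dipath \<beta>"
    and eq: "\<alpha> 0 = \<beta> 0" "\<alpha> 1 = \<beta> 1"
    and le: "\<And>t. t \<in> {0..1} \<Longrightarrow> fst (\<alpha> t) \<le> fst (\<beta> t) \<and> snd (\<alpha> t) \<le> snd (\<beta> t)"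
  shows "(H \<circ> \<alpha>, H \<circ> \<beta>) \<in> direl X D"
proof (rule direl_dihtpy)
  show "H \<circ> \<alpha> \<in> D" "H \<circ> \<beta> \<in> D" using H a b by (auto simp: dsquare_def)
  define \<Phi> where "\<Phi> = (\<lambda>x. ((1 - fst x) * fst (\<alpha> (snd x)) + fst x * fst (\<beta> (snd x)),
                            (1 - fst x) * snd (\<alpha> (snd x)) + fst x * snd (\<beta> (snd x))))"
  note A = sq_dipathD[OF a] and B = sq_dipathD[OF b]
  have c: "continuous_on ({0..1} \<times> {0..1}) (\<lambda>x::real \<times> real. f (snd x))"
    if "continuous_on {0..1} f" for f :: "real \<Rightarrow> real"
    by (rule continuous_on_compose2[OF that]) (auto intro!: continuous_intros)
  have "dsquare X D (H \<circ> \<Phi>)"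
  proof (rule dsquare_comp[OF H])
    show "continuous_on ({0..1} \<times> {0..1}) \<Phi>"
      unfolding \<Phi>_def by (intro continuous_intros c A B)
    show m: "fst (\<Phi> x) \<le> fst (\<Phi> y) \<and> snd (\<Phi> x) \<le> snd (\<Phi> y)"
      if "x \<in> {0..1} \<times> {0..1}" "y \<in> {0..1} \<times> {0..1}" "fst x \<le> fst y" "snd x \<le> snd y" for x y
      using that A(4)[of "snd x" "snd y"] B(4)[of "snd x" "snd y"] le[of "snd x"]
      unfolding \<Phi>_def by (auto intro!: convex_combination_mono)
    show "\<Phi> ` ({0..1} \<times> {0..1}) \<subseteq> {0..1} \<times> {0..1}"
    proof (rule image_subsetI)
      fix x :: "real \<times> real" assume "x \<in> {0..1} \<times> {0..1}"
      hence st: "fst x \<in> {0..1}" "snd x \<in> {0..1}" by auto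
      have "(1 - fst x) * v + fst x * w \<in> {0..1}" if "v \<in> {0..1}" "w \<in> {0..1}" for v w
        using that st convexD[of "{0..1::real}" v w "1 - fst x" "fst x"] by auto
      thus "\<Phi> x \<in> {0..1} \<times> {0..1}"
        using A(3)[OF st(2)] B(3)[OF st(2)] by (simp add: \<Phi>_def)
    qed
  qed
  thus "dihtpy X D (H \<circ> \<alpha>) (H \<circ> \<beta>)"
    unfolding dihtpy_iff_dsquare
    by (intro exI[of _ "H \<circ> \<Phi>"]) (auto simp: \<Phi>_def eq algebra_simps)
qed

text \<open>Two monotone paths with common endpoints need not be comparable, but both lie below their
  pointwise maximum; this yields a zigzag of two directed homotopies.\<close>
lemma dsquare_paths:
  assumes H: "dsquare X D H" and a: "sq_dipath \<alpha>" and b: "sq_dipath \<beta>"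
    and eq: "\<alpha> 0 = \<beta> 0" "\<alpha> 1 = \<beta> 1"
  shows "(H \<circ> \<alpha>, H \<circ> \<beta>) \<in> direl X D"
proof -
  define \<mu> where "\<mu> = (\<lambda>t. (max (fst (\<alpha> t)) (fst (\<beta> t)), max (snd (\<alpha> t)) (snd (\<beta> t))))"
  note A = sq_dipathD[OF a] and B = sq_dipathD[OF b]
  have m: "sq_dipath \<mu>"
    unfolding \<mu>_def
  proof (rule sq_dipathI)
    show "max (fst (\<alpha> s)) (fst (\<beta> s)) \<le> max (fst (\<alpha> t)) (fst (\<beta> t)) \<and>
          max (snd (\<alpha> s)) (snd (\<beta> s)) \<le> max (snd (\<alpha> t)) (snd (\<beta> t))"
      if "0 \<le> s" "s \<le> t" "t \<le> 1" for s t
      using A(4)[OF that] B(4)[OF that] by auto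
    show "max (fst (\<alpha> t)) (fst (\<beta> t)) \<in> {0..1} \<and> max (snd (\<alpha> t)) (snd (\<beta> t)) \<in> {0..1}"
      if "t \<in> {0..1}" for t
      using A(3)[OF that] B(3)[OF that] by auto
  qed (intro continuous_intros A B)+
  have "(H \<circ> \<alpha>, H \<circ> \<mu>) \<in> direl X D" "(H \<circ> \<beta>, H \<circ> \<mu>) \<in> direl X D"
    by (rule dsquare_paths_le[OF H a m] dsquare_paths_le[OF H b m]; simp add: \<mu>_def eq)+
  thus ?thesis by (blast intro: direl_trans direl_sym)
qed

subsection \<open>Reparametrization and concatenation\<close>

text \<open>Both reparametrizations are monotone paths along one edge of the square
  \<open>p \<circ> fst\<close>, so common endpoints suffice and neither has to lie below the
  other.\<close>

lemma direl_reparam: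
  assumes X: "d_space X D" and p: "p \<in> D"
    and f: "continuous_on {0..1} \<phi>" "\<phi> ` {0..1} \<subseteq> {0..1}" "mono_on {0..1} \<phi>"
    and g: "continuous_on {0..1} \<psi>" "\<psi> ` {0..1} \<subseteq> {0..1}" "mono_on {0..1} \<psi>"
    and eq: "\<phi> 0 = \<psi> 0" "\<phi> 1 = \<psi> 1"
  shows "(p \<circ> \<phi>, p \<circ> \<psi>) \<in> direl X D"
proof -
  have "sq_dipath (\<lambda>t. (\<phi> t, 0))" "sq_dipath (\<lambda>t. (\<psi> t, 0))"
    using f g by (auto intro!: sq_dipathI simp: mono_on_def image_subset_iff)
  from dsquare_paths[OF dsquare_fst[OF X p] this] show ?thesis using eq by (simp add: o_def)
qed

text \<open>Paths that agree on the unit interval may differ as total functions. Homotopies see only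
  the unit interval, so \<open>p \<circ> snd\<close> is a homotopy that also ends at
  \<open>q\<close>.\<close>

lemma direl_eq_on:
  assumes X: "d_space X D" and "p \<in> D" "q \<in> D" and eq: "\<And>t. t \<in> {0..1} \<Longrightarrow> p t = q t"
  shows "(p, q) \<in> direl X D"
proof (rule direl_dihtpy)
  show "dihtpy X D p q"
    unfolding dihtpy_iff_dsquare using dsquare_snd[OF X \<open>p \<in> D\<close>] eq
    by (intro exI[of _ "p \<circ> snd"]) auto
qed fact+

lemma direl_reparam_eq:
  assumes X: "d_space X D" and "p \<in> D" "q \<in> D"
    and f: "continuous_on {0..1} \<phi>" "\<phi> ` {0..1} \<subseteq> {0..1}" "mono_on {0..1} \<phi>"
    and end01: "\<phi> 0 = 0" "\<phi> 1 = 1"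
    and eq: "\<And>t. t \<in> {0..1} \<Longrightarrow> q t = p (\<phi> t)"
  shows "(p, q) \<in> direl X D"
proof -
  have "(p \<circ> (\<lambda>t. t), p \<circ> \<phi>) \<in> direl X D"
    using assms by (intro direl_reparam) (auto simp: mono_on_def)
  moreover have "(p \<circ> \<phi>, q) \<in> direl X D"
    using assms d_space_reparam[OF X \<open>p \<in> D\<close> f] by (intro direl_eq_on[OF X]) auto
  ultimately show ?thesis by (auto simp: o_def intro: direl_trans)
qed

lemma mono_on_max: "mono_on S f \<Longrightarrow> mono_on S g \<Longrightarrow> mono_on S (\<lambda>x. max (f x) (g x :: real))"
  unfolding mono_on_def by (meson max.mono)

lemma mono_on_min: "mono_on S f \<Longrightarrow> mono_on S g \<Longrightarrow> mono_on S (\<lambda>x. min (f x) (g x :: real))"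
  unfolding mono_on_def by (meson min.mono)

lemma direl_join_assoc:
  assumes X: "d_space X D" and D: "p \<in> D" "q \<in> D" "r \<in> D" and eq: "p 1 = q 0" "q 1 = r 0"
  shows "((p +++ q) +++ r, p +++ (q +++ r)) \<in> direl X D"
proof (rule direl_reparam_eq[OF X])
  \<comment> \<open>This is the reparametrization with breakpoints 1/2 and 3/4 and slopes 1/2, 1 and
    2. Increasing slopes make it the maximum of its affine pieces, and this form gives monotonicity
    and continuity at once.\<close>
  let ?f = "\<lambda>t::real. max (t / 2) (max (t - 1/4) (2 * t - 1))"
  show "(p +++ q) +++ r \<in> D" "p +++ (q +++ r) \<in> D"
    using assms by (auto intro!: d_space_join[OF X])
  show "continuous_on {0..1} ?f" by (intro continuous_intros) auto
  show "mono_on {0..1} ?f" by (intro mono_on_max) (auto intro: mono_onI)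
  show "(p +++ (q +++ r)) t = ((p +++ q) +++ r) (?f t)" if "t \<in> {0..1}" for t
  proof -
    consider "t \<le> 1/2" | "1/2 < t" "t \<le> 3/4" | "3/4 < t" by linarith
    thus ?thesis
    proof cases
      case 1 hence "?f t = t / 2" by auto
      thus ?thesis using 1 by (simp add: joinpaths_def)
    next
      case 2 hence "?f t = t - 1/4" by auto
      thus ?thesis using 2 by (simp add: joinpaths_def algebra_simps)
    next
      case 3 hence "?f t = 2 * t - 1" by auto
      thus ?thesis using 3 by (simp add: joinpaths_def algebra_simps)
    qed
  qed
qed (auto simp: max_def)

lemma direl_join_const:
  assumes X: "d_space X D" and p: "p \<in> D"
  shows "(p, p +++ (\<lambda>t. p 1)) \<in> direl X D" "(p, (\<lambda>t. p 0) +++ p) \<in> direl X D"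
proof -
  note e = d_space_endpoints[OF X p]
  show "(p, p +++ (\<lambda>t. p 1)) \<in> direl X D"
  proof (rule direl_reparam_eq[OF X p, where \<phi> = "\<lambda>t. min (2 * t) 1"])
    show "p +++ (\<lambda>t. p 1) \<in> D" using e p by (intro d_space_join[OF X] d_space_const[OF X]) auto
  qed (auto intro!: continuous_intros mono_on_min mono_onI simp: joinpaths_def)
  show "(p, (\<lambda>t. p 0) +++ p) \<in> direl X D"
  proof (rule direl_reparam_eq[OF X p, where \<phi> = "\<lambda>t. max (2 * t - 1) 0"])
    show "(\<lambda>t. p 0) +++ p \<in> D" using e p by (intro d_space_join[OF X] d_space_const[OF X]) auto
  qed (auto intro!: continuous_intros mono_on_max mono_onI simp: joinpaths_def)
qed

text \<open>Both sides are reparametrizations of \<open>p\<close> itself that run from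
  \<open>a\<close> to \<open>c\<close>, one at constant speed and one with a change of speed at
  \<open>b\<close>, so \<open>direl_reparam\<close> applies.\<close>

lemma direl_subdipath_join:
  assumes X: "d_space X D" and p: "p \<in> D" and ab: "0 \<le> a" "a \<le> b" "b \<le> c" "c \<le> 1"
  shows "(subdipath a c p, subdipath a b p +++ subdipath b c p) \<in> direl X D"
proof -
  define \<phi> where "\<phi> = (\<lambda>t::real. (c - a) * t + a)"
  define \<psi> where "\<psi> = (\<lambda>t. (b - a) * t + a) +++ (\<lambda>t. (c - b) * t + b)"
  have "path \<psi>" unfolding \<psi>_def
    by (rule path_join_imp) (auto simp: path_def pathfinish_def pathstart_def intro!: continuous_intros)
  hence c: "continuous_on {0..1} \<psi>" by (simp add: path_def)
  have m: "mono_on {0..1} \<psi>"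
  proof (rule mono_onI)
    fix s t :: real assume st: "s \<in> {0..1}" "t \<in> {0..1}" "s \<le> t"
    have 1: "(b - a) * (2 * s) \<le> (b - a) * (2 * t)" "(c - b) * (2 * s) \<le> (c - b) * (2 * t)"
      using st ab by (intro mult_left_mono; simp)+
    have 2: "(b - a) * (2 * s) \<le> b - a" if "s \<le> 1/2" using ab that mult_left_le[of "2 * s" "b - a"] by auto
    have 3: "0 \<le> (c - b) * (2 * t - 1)" if "t > 1/2" using ab that by auto
    show "\<psi> s \<le> \<psi> t" using 1 2 3 st(3) unfolding \<psi>_def joinpaths_def
      by (cases "s \<le> 1/2"; cases "t \<le> 1/2") (auto simp: right_diff_distrib)
  qed
  have i: "\<psi> ` {0..1} \<subseteq> {0..1}"
  proof (rule image_subsetI)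
    fix t :: real assume "t \<in> {0..1}"
    hence "\<psi> 0 \<le> \<psi> t" "\<psi> t \<le> \<psi> 1" using m by (auto simp: mono_on_def)
    thus "\<psi> t \<in> {0..1}" using ab by (auto simp: \<psi>_def)
  qed
  have m': "mono_on {0..1} \<phi>" unfolding \<phi>_def using ab by (intro mono_on_scale) auto
  have i': "\<phi> ` {0..1} \<subseteq> {0..1}"
  proof (rule image_subsetI)
    fix t :: real assume "t \<in> {0..1}"
    hence "\<phi> 0 \<le> \<phi> t" "\<phi> t \<le> \<phi> 1" using m' unfolding mono_on_def by auto
    thus "\<phi> t \<in> {0..1}" using ab by (auto simp: \<phi>_def)
  qed
  have "(p \<circ> \<phi>, p \<circ> \<psi>) \<in> direl X D"
    by (rule direl_reparam[OF X p _ i' m' c i m]) (auto simp: \<phi>_def \<psi>_def intro!: continuous_intros)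
  moreover have "p \<circ> \<phi> = subdipath a c p" "p \<circ> \<psi> = subdipath a b p +++ subdipath b c p"
    by (auto simp: \<phi>_def \<psi>_def subdipath_def joinpaths_def)
  ultimately show ?thesis by simp
qed

text \<open>Dipaths are total functions on the reals, so the values of \<open>f\<close> off the unit interval
  must be matched as well. Reparametrizations are unconstrained there: extending them by a logarithm
  makes every value of \<open>r1\<close> and \<open>r2\<close> available.\<close>
lemma d_space_glue:
  assumes X: "d_space X D" and r: "r1 \<in> D" "r2 \<in> D" and c: "0 < c" "c < 1"
    and f1: "\<And>t. t \<in> {0..1} \<Longrightarrow> f (c * t) = r1 t"
    and f2: "\<And>t. t \<in> {0..1} \<Longrightarrow> f (c + (1 - c) * t) = r2 t"
    and junk: "\<And>t. t \<notin> {0..1} \<Longrightarrow> f t \<in> range r1 \<union> range r2"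
  shows "f \<in> D"
proof -
  define \<phi>1 where "\<phi>1 = (\<lambda>w::real. if w < 0 then ln (- w) else w)"
  define \<phi>2 where "\<phi>2 = (\<lambda>w::real. if w > 1 then ln (w - 1) else w)"
  have "r1 \<circ> \<phi>1 \<in> D"
  proof (rule d_space_reparam[OF X r(1)])
    show "continuous_on {0..1} \<phi>1" 
      by (rule continuous_on_eq[of _ "\<lambda>t. t"]) (auto simp: \<phi>1_def)
  qed (auto simp: \<phi>1_def mono_on_def)
  moreover have "r2 \<circ> \<phi>2 \<in> D"
  proof (rule d_space_reparam[OF X r(2)])
    show "continuous_on {0..1} \<phi>2" 
      by (rule continuous_on_eq[of _ "\<lambda>t. t"]) (auto simp: \<phi>2_def)
  qed (auto simp: \<phi>2_def mono_on_def)
  moreover have "(r1 \<circ> \<phi>1) 1 = (r2 \<circ> \<phi>2) 0"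
    using f1[of 1] f2[of 0] by (simp add: \<phi>1_def \<phi>2_def)
  ultimately have r: "(r1 \<circ> \<phi>1) +++ (r2 \<circ> \<phi>2) \<in> D" (is "?r \<in> D") by (rule d_space_join[OF X])
  have "\<exists>w. ?r w = f t" if t: "t \<notin> {0..1}" for t
  proof -
    from junk[OF t] consider x where "f t = r1 x" | x where "f t = r2 x" by auto
    thus ?thesis
    proof cases
      case 1
      moreover have "- exp x / 2 \<le> 1 / 2" using exp_gt_zero[of x] by linarith
      \<comment> \<open>The first half of a concatenation runs at double speed, so at this time
        \<open>r1\<close> is evaluated at \<open>ln (exp x)\<close>, that is, at
        \<open>x\<close>.\<close>
      ultimately show ?thesis by (intro exI[of _ "- exp x / 2"]) (simp add: joinpaths_def \<phi>1_def)
    next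
      case 2
      have "\<not> 1 + exp x / 2 \<le> 1 / 2" by (simp add: not_le add_strict_increasing)
      moreover have "2 * (1 + exp x / 2) - 1 = 1 + exp x" by simp
      ultimately show ?thesis using 2 by (intro exI[of _ "1 + exp x / 2"]) (auto simp: joinpaths_def \<phi>2_def)
    qed
  qed
  then obtain w where w: "\<And>t. t \<notin> {0..1} \<Longrightarrow> ?r (w t) = f t" by metis
  \<comment> \<open>Inside the interval the two slopes move the joint of the concatenation from 1/2
    to \<open>c\<close>. Outside, \<open>w\<close> picks a time at which the concatenation has the
    prescribed value; monotonicity is demanded on the unit interval only.\<close>
  define \<theta> where "\<theta> t = (if t \<in> {0..1} then (if t \<le> c then t / (2 * c) else 1/2 + (t - c) / (2 * (1 - c))) else w t)" for t
  have "?r \<circ> \<theta> \<in> D"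
  proof (rule d_space_reparam[OF X r])
    have "continuous_on {0..1} (\<lambda>t. if t \<le> c then t / (2 * c) else 1/2 + (t - c) / (2 * (1 - c)))"
      using c by (intro continuous_on_cases_le continuous_intros) auto
    thus "continuous_on {0..1} \<theta>" by (rule continuous_on_eq) (auto simp: \<theta>_def)
    show m: "mono_on {0..1} \<theta>"
    proof (rule mono_onI)
      fix s t :: real assume st: "s \<in> {0..1}" "t \<in> {0..1}" "s \<le> t"
      have "s / (2 * c) \<le> 1/2" if "s \<le> c" using c that by (simp add: field_simps)
      moreover have "0 \<le> (t - c) / (2 * (1 - c))" if "t > c" using c that by simp
      ultimately have "s / (2 * c) \<le> 1/2 + (t - c) / (2 * (1 - c))" if "s \<le> c" "t > c"
        using that by linarith
      thus "\<theta> s \<le> \<theta> t" using st c by (auto simp: \<theta>_def divide_right_mono simp del: right_diff_distrib_numeral)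
    qed
    show "\<theta> ` {0..1} \<subseteq> {0..1}"
    proof (rule image_subsetI)
      fix t :: real assume "t \<in> {0..1}"
      hence "\<theta> 0 \<le> \<theta> t" "\<theta> t \<le> \<theta> 1" using m by (auto simp: mono_on_def)
      moreover have "\<theta> 0 = 0" "\<theta> 1 = 1" using c by (simp_all add: \<theta>_def divide_simps)
      ultimately show "\<theta> t \<in> {0..1}" by simp
    qed
  qed
  moreover have "?r (\<theta> t) = f t" for t
  proof (cases "t \<in> {0..1}")
    case False
    hence "\<theta> t = w t" unfolding \<theta>_def by (rule if_not_P)
    thus ?thesis using w[OF False] by simp
  next
    case t: True
    show ?thesis
    proof (cases "t \<le> c")
      case True
      hence "t / (2 * c) \<le> 1/2" "t / c \<in> {0..1}" "\<not> t / c < 0" using c t by (simp_all add: field_simps)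
      thus ?thesis using True t c f1[of "t / c"] by (auto simp: \<theta>_def joinpaths_def \<phi>1_def)
    next
      case False
      hence "\<not> 1/2 + (t - c) / (2 * (1 - c)) \<le> 1/2" "(t - c) / (1 - c) \<in> {0..1}" "\<not> (t - c) / (1 - c) > 1"
        using c t by (simp_all add: field_simps)
      moreover have "2 * (1/2 + (t - c) / (2 * (1 - c))) - 1 = (t - c) / (1 - c)" using c by (simp add: field_simps)
      ultimately show ?thesis using False t c f2[of "(t - c) / (1 - c)"]
        by (auto simp: \<theta>_def joinpaths_def \<phi>2_def)
    qed
  qed
  ultimately show ?thesis by (simp add: o_def)
qed

lemma sq_dipath_join:
  assumes a: "sq_dipath \<alpha>" and b: "sq_dipath \<beta>" and eq: "\<alpha> 1 = \<beta> 0"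
  shows "sq_dipath (\<alpha> +++ \<beta>)"
proof -
  note A = sq_dipathD[OF a] and B = sq_dipathD[OF b]
  have "path (\<alpha> +++ \<beta>)"
    using a b eq by (intro path_join_imp) (auto simp: sq_dipath_def path_def pathfinish_def pathstart_def)
  moreover have "(\<alpha> +++ \<beta>) ` {0..1} \<subseteq> {0..1} \<times> {0..1}"
    using a b by (auto simp: sq_dipath_def joinpaths_def image_subset_iff)
  moreover have "fst ((\<alpha> +++ \<beta>) s) \<le> fst ((\<alpha> +++ \<beta>) t) \<and> snd ((\<alpha> +++ \<beta>) s) \<le> snd ((\<alpha> +++ \<beta>) t)"
    if st: "0 \<le> s" "s \<le> t" "t \<le> 1" for s t
  proof -
    consider "t \<le> 1/2" | "s \<le> 1/2" "t > 1/2" | "s > 1/2" by linarith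
    thus ?thesis
    proof cases
      case 1 thus ?thesis using A(4)[of "2 * s" "2 * t"] st by (simp add: joinpaths_def)
    next
      case 2 thus ?thesis using A(4)[of "2 * s" 1] B(4)[of 0 "2 * t - 1"] st eq
        by (force simp: joinpaths_def)
    next
      case 3 thus ?thesis using B(4)[of "2 * s - 1" "2 * t - 1"] st by (simp add: joinpaths_def)
    qed
  qed
  ultimately show ?thesis unfolding sq_dipath_def path_def by (auto intro!: mono_onI)
qed

lemma sq_dipath_line:
  assumes "0 \<le> a" "a \<le> b" "b \<le> 1" "0 \<le> c" "c \<le> d" "d \<le> 1"
  shows "sq_dipath (\<lambda>t. ((1 - t) * a + t * b, (1 - t) * c + t * d))"
proof (rule sq_dipathI)
  have conv: "(1 - t) * v + t * w \<in> {0..1}" if "v \<in> {0..1}" "w \<in> {0..1}" "t \<in> {0..1}" for v w t :: real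
    using that convexD[of "{0..1::real}" v w "1 - t" t] by auto
  show "(1 - t) * a + t * b \<in> {0..1} \<and> (1 - t) * c + t * d \<in> {0..1}" if "t \<in> {0..1}" for t
    using assms that by (intro conjI conv) auto
  show "(1 - s) * a + s * b \<le> (1 - t) * a + t * b \<and> (1 - s) * c + s * d \<le> (1 - t) * c + t * d"
    if "0 \<le> s" "s \<le> t" "t \<le> 1" for s t
    using assms that by (intro conjI convex_combination_mono) auto
qed (intro continuous_intros)+

text \<open>A path that avoids the line at height 1/2 cannot be cut there. A path from corner to
  corner must cross it, at a time strictly between 0 and 1, and every monotone path is a piece of
  such a one.\<close>

lemma sq_dipath_extend:
  assumes g: "sq_dipath \<gamma>"
  obtains \<gamma>' \<phi> where "sq_dipath \<gamma>'" "\<gamma>' 0 = (0, 0)" "\<gamma>' 1 = (1, 1)" "\<gamma> = \<gamma>' \<circ> \<phi>"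
    "continuous_on {0..1} \<phi>" "\<phi> ` {0..1} \<subseteq> {0..1}" "mono_on {0..1} \<phi>"
proof -
  define l1 where "l1 = (\<lambda>t. ((1 - t) * 0 + t * fst (\<gamma> 0), (1 - t) * 0 + t * snd (\<gamma> 0)))"
  define l2 where "l2 = (\<lambda>t. ((1 - t) * fst (\<gamma> 1) + t * 1, (1 - t) * snd (\<gamma> 1) + t * 1))"
  define J where "J = l1 +++ (\<gamma> +++ l2)"
  \<comment> \<open>Off the unit interval the values of \<open>\<gamma>\<close> are kept, so that
    the factorization of \<open>\<gamma>\<close> is an equation of total functions.\<close>
  define \<gamma>' where "\<gamma>' = (\<lambda>t. if t \<in> {0..1} then J t else \<gamma> t)"
  \<comment> \<open>In the threefold concatenation \<open>J\<close> the path \<open>\<gamma>\<close>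
    occupies the times from 1/2 to 3/4.\<close>
  define \<phi> where "\<phi> = (\<lambda>t::real. if t \<in> {0..1} then 1/4 * t + 1/2 else t)"
  have "sq_dipath l1" "sq_dipath l2"
    unfolding l1_def l2_def using sq_dipathD(3)[OF g, of 0] sq_dipathD(3)[OF g, of 1]
    by (intro sq_dipath_line; simp)+
  hence "sq_dipath J"
    unfolding J_def by (intro sq_dipath_join g) (auto simp: l1_def l2_def)
  moreover from this have "continuous_on {0..1} \<gamma>'"
    unfolding sq_dipath_def by (auto intro: continuous_on_eq[of _ J] simp: \<gamma>'_def)
  ultimately have "sq_dipath \<gamma>'"
    unfolding sq_dipath_def by (auto simp: mono_on_def image_subset_iff \<gamma>'_def)
  moreover have "\<gamma>' 0 = (0, 0)" "\<gamma>' 1 = (1, 1)"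
    by (auto simp: \<gamma>'_def J_def l1_def l2_def)
  moreover have "\<gamma> t = \<gamma>' (\<phi> t)" for t
  proof (cases "t \<in> {0..1}")
    case t: True
    hence "J (1/4 * t + 1/2) = \<gamma> t"
      by (cases "t = 0") (auto simp: J_def joinpaths_def l1_def)
    thus ?thesis using t by (auto simp: \<gamma>'_def \<phi>_def)
  qed (auto simp: \<gamma>'_def \<phi>_def)
  hence "\<gamma> = \<gamma>' \<circ> \<phi>" by (auto simp: o_def)
  moreover have "continuous_on {0..1} \<phi>"
    by (rule continuous_on_eq[of _ "\<lambda>t. 1/4 * t + 1/2"]) (auto simp: \<phi>_def intro!: continuous_intros)
  moreover have "\<phi> ` {0..1} \<subseteq> {0..1}" "mono_on {0..1} \<phi>"
    by (auto simp: \<phi>_def mono_on_def)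
  ultimately show ?thesis using that by blast
qed

text \<open>The homotopies are placed side by side in the path variable. The work is to show that
  the result sends monotone paths to dipaths: such a path is cut where it crosses height 1/2, and
  the images of the two pieces are put together by \<open>d_space_glue\<close>.\<close>

lemma dihtpy_join:
  assumes X: "d_space X D" and pp: "dihtpy X D p p'" and qq: "dihtpy X D q q'" and eq: "p 1 = q 0"
  shows "dihtpy X D (p +++ q) (p' +++ q')"
proof -
  obtain H1 where H1: "dsquare X D H1" "\<And>t. t \<in> {0..1} \<Longrightarrow> H1 (0, t) = p t \<and> H1 (1, t) = p' t"
     "\<And>s. s \<in> {0..1} \<Longrightarrow> H1 (s, 0) = p 0 \<and> H1 (s, 1) = p 1"
    using pp unfolding dihtpy_iff_dsquare by blast
  obtain H2 where H2: "dsquare X D H2" "\<And>t. t \<in> {0..1} \<Longrightarrow> H2 (0, t) = q t \<and> H2 (1, t) = q' t"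
     "\<And>s. s \<in> {0..1} \<Longrightarrow> H2 (s, 0) = q 0 \<and> H2 (s, 1) = q 1"
    using qq unfolding dihtpy_iff_dsquare by blast
  define H where "H = (\<lambda>x. if snd x \<le> 1/2 then H1 (fst x, 2 * snd x) else H2 (fst x, 2 * snd x - 1))"
  have "continuous_on ({0..1} \<times> {0..1}) H"
    unfolding H_def
  proof (rule continuous_on_cases_le)
    show "continuous_on {t \<in> {0..1} \<times> {0..1}. snd t \<le> 1/2} (\<lambda>t. H1 (fst t, 2 * snd t))"
      using H1(1) unfolding dsquare_def
      by (elim conjE, elim continuous_on_compose2) (auto intro!: continuous_intros)
    show "continuous_on {t \<in> {0..1} \<times> {0..1}. 1/2 \<le> snd t} (\<lambda>t. H2 (fst t, 2 * snd t - 1))"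
      using H2(1) unfolding dsquare_def
      by (elim conjE, elim continuous_on_compose2) (auto intro!: continuous_intros)
    show "H1 (fst t, 2 * snd t) = H2 (fst t, 2 * snd t - 1)"
      if "t \<in> {0..1} \<times> {0..1}" "snd t = 1/2" for t
    proof -
      have "2 * snd t = 1" "fst t \<in> {0..1}" using that by auto
      thus ?thesis using H1(3)[of "fst t"] H2(3)[of "fst t"] eq by simp
    qed
  qed (intro continuous_intros)
  moreover have "H ` ({0..1} \<times> {0..1}) \<subseteq> X"
    using H1(1) H2(1) unfolding dsquare_def H_def by (auto simp: image_subset_iff)
  moreover have glue: "H \<circ> \<gamma> \<in> D" if g: "sq_dipath \<gamma>" and g0: "\<gamma> 0 = (0, 0)" and g1: "\<gamma> 1 = (1, 1)" for \<gamma>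
  proof -
    note G = sq_dipathD[OF g]
    obtain c where c: "0 \<le> c" "c \<le> 1" "snd (\<gamma> c) = 1/2"
      using IVT'[of "\<lambda>t. snd (\<gamma> t)" 0 "1/2" 1] g0 g1 G(2) by auto
    \<comment> \<open>The gluing lemma asks for a cut strictly inside the interval; the two corners
      provide it.\<close>
    have c01: "0 < c" "c < 1" using c g0 g1 by (cases "c = 0"; cases "c = 1"; simp)+
    \<comment> \<open>Off the unit interval the values are those of \<open>\<gamma>\<close>, so that
      there the values of \<open>H \<circ> \<gamma>\<close> occur among those of the two
      pieces.\<close>
    define \<gamma>1 where "\<gamma>1 = (\<lambda>t. if t \<in> {0..1} then \<gamma> (c * t) else \<gamma> t)"
    define \<gamma>2 where "\<gamma>2 = (\<lambda>t. if t \<in> {0..1} then \<gamma> (c + (1 - c) * t) else \<gamma> t)"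
    have in1: "c * t \<in> {0..1}" "c * t \<le> c" if "t \<in> {0..1}" for t
      using that c mult_left_le[of t c] by auto
    have in2: "c + (1 - c) * t \<in> {0..1}" "c \<le> c + (1 - c) * t" if "t \<in> {0..1}" for t
      using that c mult_left_le[of t "1 - c"] by auto
    have le1: "snd (\<gamma> (c * t)) \<le> 1/2" if "t \<in> {0..1}" for t
      using G(4)[of "c * t" c] in1[OF that] c by auto
    have ge2: "1/2 \<le> snd (\<gamma> (c + (1 - c) * t))" if "t \<in> {0..1}" for t
      using G(4)[of c "c + (1 - c) * t"] in2[OF that] c by auto
    have "sq_dipath (\<lambda>t. (fst (\<gamma>1 t), 2 * snd (\<gamma>1 t)))"
    proof (rule sq_dipathI)
      have *: "continuous_on {0..1} (\<lambda>t. f (\<gamma>1 t))" if "continuous_on {0..1} (\<lambda>t. f (\<gamma> t))"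
        for f :: "real \<times> real \<Rightarrow> real"
      proof (rule continuous_on_eq)
        show "continuous_on {0..1} (\<lambda>t. f (\<gamma> (c * t)))"
          by (rule continuous_on_compose2[OF that]) (use in1 in \<open>auto intro!: continuous_intros\<close>)
      qed (auto simp: \<gamma>1_def)
      show "continuous_on {0..1} (\<lambda>t. fst (\<gamma>1 t))" "continuous_on {0..1} (\<lambda>t. 2 * snd (\<gamma>1 t))"
        using *[of fst] *[of snd] G(1,2) by (auto intro!: continuous_intros simp del: continuous_on_fst continuous_on_snd)
      show "fst (\<gamma>1 t) \<in> {0..1} \<and> 2 * snd (\<gamma>1 t) \<in> {0..1}" if "t \<in> {0..1}" for t
        using that G(3)[of "c * t"] in1[OF that] le1[OF that] by (auto simp: \<gamma>1_def)
      show "fst (\<gamma>1 s) \<le> fst (\<gamma>1 t) \<and> 2 * snd (\<gamma>1 s) \<le> 2 * snd (\<gamma>1 t)" if "0 \<le> s" "s \<le> t" "t \<le> 1" for s t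
        using that G(4)[of "c * s" "c * t"] in1[of s] in1[of t] c by (auto simp: \<gamma>1_def mult_left_mono)
    qed
    hence r1: "H1 \<circ> (\<lambda>t. (fst (\<gamma>1 t), 2 * snd (\<gamma>1 t))) \<in> D" (is "?r1 \<in> D")
      using H1(1) by (auto simp: dsquare_def)
    have "sq_dipath (\<lambda>t. (fst (\<gamma>2 t), 2 * snd (\<gamma>2 t) - 1))"
    proof (rule sq_dipathI)
      have *: "continuous_on {0..1} (\<lambda>t. f (\<gamma>2 t))" if "continuous_on {0..1} (\<lambda>t. f (\<gamma> t))"
        for f :: "real \<times> real \<Rightarrow> real"
      proof (rule continuous_on_eq)
        show "continuous_on {0..1} (\<lambda>t. f (\<gamma> (c + (1 - c) * t)))"
          by (rule continuous_on_compose2[OF that]) (use in2 in \<open>auto intro!: continuous_intros\<close>)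
      qed (auto simp: \<gamma>2_def)
      show "continuous_on {0..1} (\<lambda>t. fst (\<gamma>2 t))" "continuous_on {0..1} (\<lambda>t. 2 * snd (\<gamma>2 t) - 1)"
        using *[of fst] *[of snd] G(1,2) by (auto intro!: continuous_intros simp del: continuous_on_fst continuous_on_snd)
      show "fst (\<gamma>2 t) \<in> {0..1} \<and> 2 * snd (\<gamma>2 t) - 1 \<in> {0..1}" if "t \<in> {0..1}" for t
        using that G(3)[of "c + (1 - c) * t"] in2[OF that] ge2[OF that] by (auto simp: \<gamma>2_def)
      show "fst (\<gamma>2 s) \<le> fst (\<gamma>2 t) \<and> 2 * snd (\<gamma>2 s) - 1 \<le> 2 * snd (\<gamma>2 t) - 1" if "0 \<le> s" "s \<le> t" "t \<le> 1" for s t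
        using that G(4)[of "c + (1 - c) * s" "c + (1 - c) * t"] in2[of s] in2[of t] c
        by (auto simp: \<gamma>2_def mult_left_mono)
    qed
    hence r2: "H2 \<circ> (\<lambda>t. (fst (\<gamma>2 t), 2 * snd (\<gamma>2 t) - 1)) \<in> D" (is "?r2 \<in> D")
      using H2(1) by (auto simp: dsquare_def)
    show ?thesis
    proof (rule d_space_glue[OF X r1 r2 c01])
      show "(H \<circ> \<gamma>) (c * t) = ?r1 t" if "t \<in> {0..1}" for t
        using that le1[OF that] by (auto simp: H_def \<gamma>1_def)
      show "(H \<circ> \<gamma>) (c + (1 - c) * t) = ?r2 t" if "t \<in> {0..1}" for t
      \<comment> \<open>At height exactly 1/2 the definition of \<open>H\<close> takes
        \<open>H1\<close> whereas the second piece uses \<open>H2\<close>; these edges are constant,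
        with values \<open>p 1\<close> and \<open>q 0\<close>.\<close>
      proof (cases "snd (\<gamma> (c + (1 - c) * t)) = 1/2")
        case True
        hence "2 * snd (\<gamma> (c + (1 - c) * t)) = 1" by simp
        moreover have "fst (\<gamma> (c + (1 - c) * t)) \<in> {0..1}" using G(3)[OF in2(1)[OF that]] by simp
        moreover have "snd (\<gamma> (c + (1 - c) * t)) \<le> 1/2" using True by simp
        ultimately have "(H \<circ> \<gamma>) (c + (1 - c) * t) = p 1" "?r2 t = q 0"
          using that H1(3) H2(3) by (simp_all only: H_def \<gamma>2_def o_def if_True diff_self)
        thus ?thesis using eq by simp
      next
        case False
        thus ?thesis using that ge2[OF that] by (simp add: H_def \<gamma>2_def)
      qed
      show "(H \<circ> \<gamma>) t \<in> range ?r1 \<union> range ?r2" if t: "t \<notin> {0..1}" for t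
      proof (cases "snd (\<gamma> t) \<le> 1/2")
        case True
        hence "(H \<circ> \<gamma>) t = ?r1 t" using t by (auto simp: H_def \<gamma>1_def)
        thus ?thesis by (rule UnI1[OF range_eqI])
      next
        case False
        hence "(H \<circ> \<gamma>) t = ?r2 t" using t by (auto simp: H_def \<gamma>2_def)
        thus ?thesis by (rule UnI2[OF range_eqI])
      qed
    qed
  qed
  moreover have "H \<circ> \<gamma> \<in> D" if "sq_dipath \<gamma>" for \<gamma>
  proof -
    from sq_dipath_extend[OF that] obtain \<gamma>' \<phi> where *: "sq_dipath \<gamma>'" "\<gamma>' 0 = (0, 0)" "\<gamma>' 1 = (1, 1)"
      "\<gamma> = \<gamma>' \<circ> \<phi>" "continuous_on {0..1} \<phi>" "\<phi> ` {0..1} \<subseteq> {0..1}" "mono_on {0..1} \<phi>" .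
    show ?thesis using d_space_reparam[OF X glue[OF *(1-3)] *(5-7)] *(4) by (simp add: o_assoc)
  qed
  ultimately have "dsquare X D H" by (simp add: dsquare_def)
  thus ?thesis
    unfolding dihtpy_iff_dsquare using H1(2,3) H2(2,3) 
    by (intro exI[of _ H]) (auto simp: H_def joinpaths_def)
qed

lemma direl_join:
  assumes X: "d_space X D" and pp: "(p, p') \<in> direl X D" and qq: "(q, q') \<in> direl X D" and eq: "p 1 = q 0"
  shows "(p +++ q, p' +++ q') \<in> direl X D"
proof -
  have refl: "dihtpy X D r r" if "r \<in> D" for r
    unfolding dihtpy_iff_dsquare using dsquare_snd[OF X that] by (intro exI[of _ "r \<circ> snd"]) auto
  \<comment> \<open>One factor is changed at a time. Equality of endpoints belongs to the induction
    because it keeps the intermediate dipaths of a zigzag composable with \<open>q\<close>.\<close>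
  have 1: "p 1 = p' 1 \<and> (p 1 = q 0 \<longrightarrow> (p +++ q, p' +++ q) \<in> direl X D)" if q: "q \<in> D" for q
    using pp
  proof (induction rule: direl_induct)
    case (dihtpy r s)
    thus ?case using dihtpy_endpoints[OF dihtpy(3)] q
      by (auto intro!: direl_dihtpy d_space_join[OF X] dihtpy_join[OF X] refl)
  qed (auto intro: direl_refl direl_sym direl_trans d_space_join[OF X] q)
  have 2: "q 0 = q' 0 \<and> (p 1 = q 0 \<longrightarrow> (p +++ q, p +++ q') \<in> direl X D)" if p: "p \<in> D" for p
    using qq
  proof (induction rule: direl_induct)
    case (dihtpy r s)
    thus ?case using dihtpy_endpoints[OF dihtpy(3)] p
      by (auto intro!: direl_dihtpy d_space_join[OF X] dihtpy_join[OF X] refl)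
  qed (auto intro: direl_refl direl_sym direl_trans d_space_join[OF X] p)
  show ?thesis
    using 1[of q] 2[of p'] direl_mem[OF pp] direl_mem[OF qq] eq by (auto intro: direl_trans)
qed

subsection \<open>Fundamental categories\<close>

text \<open>Every morphism has this form, so calculations can be done on dipaths, and the
  representatives chosen by \<open>rep\<close> disappear from view.\<close>

definition path_mor :: "(real \<Rightarrow> 'a::topological_space) set \<Rightarrow> 'a set \<Rightarrow> (real \<Rightarrow> 'a) \<Rightarrow> 'a dmor" where
  "path_mor D Y p = (p 0, p 1, dclass Y (dsub D Y) p)"

lemma fc_simps [simp]:
  "Obj (fc D Y A) = A" "Dom (fc D Y A) f = fst f" "Cod (fc D Y A) f = fst (snd f)"
  "Id (fc D Y A) a = path_mor D Y (\<lambda>t. a)"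
  by (simp_all add: fc_def fund_cat_def path_mor_def)

lemma path_mor_ends [simp]: "fst (path_mor D Y p) = p 0" "fst (snd (path_mor D Y p)) = p 1"
  by (simp_all add: path_mor_def)

lemma Mor_fc: "Mor (fc D Y A) = {path_mor D Y p |p. p \<in> dsub D Y \<and> p 0 \<in> A \<and> p 1 \<in> A}"
  by (auto simp: fc_def fund_cat_def path_mor_def)

lemma Mor_fcE:
  assumes "f \<in> Mor (fc D Y A)"
  obtains p where "f = path_mor D Y p" "p \<in> dsub D Y" "p 0 \<in> A" "p 1 \<in> A"
  using assms by (auto simp: Mor_fc)

lemma path_mor_in_Mor: "p \<in> dsub D Y \<Longrightarrow> p 0 \<in> A \<Longrightarrow> p 1 \<in> A \<Longrightarrow> path_mor D Y p \<in> Mor (fc D Y A)"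
  by (auto simp: Mor_fc)

lemma path_mor_cong: "(p, q) \<in> direl Y (dsub D Y) \<Longrightarrow> path_mor D Y p = path_mor D Y q"
  by (simp add: path_mor_def dclass_eqI direl_endpoints)

lemma path_mor_eq_on:
  assumes "d_space X D" "Y \<subseteq> X" "p \<in> dsub D Y" "q \<in> dsub D Y" "\<And>t. t \<in> {0..1} \<Longrightarrow> p t = q t"
  shows "path_mor D Y p = path_mor D Y q"
  using assms by (intro path_mor_cong direl_eq_on d_space_dsub) auto

text \<open>\<open>Comp\<close> concatenates chosen representatives; by \<open>direl_join\<close>
  any other representatives give the same class.\<close>

lemma Comp_path_mor:
  assumes X: "d_space X D" "Y \<subseteq> X" and "p \<in> dsub D Y" "q \<in> dsub D Y" "p 1 = q 0"
  shows "Comp (fc D Y A) (path_mor D Y q) (path_mor D Y p) = path_mor D Y (p +++ q)"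
proof -
  have "(p +++ q, rep (dclass Y (dsub D Y) p) +++ rep (dclass Y (dsub D Y) q)) \<in> direl Y (dsub D Y)"
    using assms by (intro direl_join[OF d_space_dsub[OF X]] rep_dclass)
  from dclass_eqI[OF this] show ?thesis by (simp add: fc_def fund_cat_def path_mor_def)
qed

lemma category_fc:
  assumes X: "d_space X D" "Y \<subseteq> X" and A: "A \<subseteq> Y"
  shows "category (fc D Y A)"
proof -
  note Y = d_space_dsub[OF X]
  let ?C = "fc D Y A"
  note comp = Comp_path_mor[OF X]
  note join = d_space_join[OF Y]
  show ?thesis
    unfolding category_def
  proof (intro conjI ballI impI)
    fix f assume "f \<in> Mor ?C"
    then obtain p where p: "f = path_mor D Y p" "p \<in> dsub D Y" "p 0 \<in> A" "p 1 \<in> A" by (rule Mor_fcE)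
    show "Dom ?C f \<in> Obj ?C" "Cod ?C f \<in> Obj ?C" using p by auto
    have const: "(\<lambda>t. p 0) \<in> dsub D Y" "(\<lambda>t. p 1) \<in> dsub D Y"
      using d_space_endpoints[OF Y p(2)] d_space_const[OF Y] by auto
    show "Comp ?C f (Id ?C (Dom ?C f)) = f" "Comp ?C (Id ?C (Cod ?C f)) f = f"
      using p const path_mor_cong[OF direl_join_const(1)[OF Y p(2)], symmetric]
        path_mor_cong[OF direl_join_const(2)[OF Y p(2)], symmetric] by (simp_all add: comp)
  next
    fix x assume "x \<in> Obj ?C"
    thus "Id ?C x \<in> hom ?C x x"
      using A by (auto simp: hom_def intro!: path_mor_in_Mor d_space_const[OF Y])
  next
    fix f g assume "f \<in> Mor ?C" "g \<in> Mor ?C" and e: "Cod ?C f = Dom ?C g"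
    then obtain p q where "f = path_mor D Y p" "p \<in> dsub D Y" "p 0 \<in> A" "p 1 \<in> A"
      "g = path_mor D Y q" "q \<in> dsub D Y" "q 0 \<in> A" "q 1 \<in> A" by (metis Mor_fcE)
    thus "Comp ?C g f \<in> hom ?C (Dom ?C f) (Cod ?C g)"
      using e join by (auto simp: comp hom_def intro!: path_mor_in_Mor)
  next
    fix f g h assume "f \<in> Mor ?C" "g \<in> Mor ?C" "h \<in> Mor ?C"
      and e: "Cod ?C f = Dom ?C g \<and> Cod ?C g = Dom ?C h"
    then obtain p q r where "f = path_mor D Y p" "p \<in> dsub D Y" "g = path_mor D Y q" "q \<in> dsub D Y"
      "h = path_mor D Y r" "r \<in> dsub D Y" by (metis Mor_fcE)
    thus "Comp ?C h (Comp ?C g f) = Comp ?C (Comp ?C h g) f"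
      using e join direl_join_assoc[OF Y, of p q r] by (simp add: comp path_mor_cong)
  qed
qed

lemma direl_mono:
  assumes "X \<subseteq> X'" "D \<subseteq> D'" and "(p, q) \<in> direl X D"
  shows "(p, q) \<in> direl X' D'"
  using assms(3)
proof (induction rule: direl_induct)
  case (dihtpy r s)
  hence "dihtpy X' D' r s" using assms(1,2) unfolding dihtpy_def by (meson subset_eq order_trans)
  thus ?case using dihtpy assms by (auto intro!: direl_dihtpy)
qed (use assms in \<open>auto intro: direl_refl direl_sym direl_trans\<close>)

lemma dsub_mono: "Y \<subseteq> Z \<Longrightarrow> dsub D Y \<subseteq> dsub D Z"
  by (auto simp: dsub_def)

text \<open>The representative chosen in \<open>Y\<close> is equivalent to \<open>p\<close> in
  \<open>Y\<close> and therefore in \<open>Z\<close>.\<close>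

lemma incl_path_mor:
  assumes "Y \<subseteq> Z" "p \<in> dsub D Y"
  shows "snd (incl D Z) (path_mor D Y p) = path_mor D Z p"
proof -
  have "(p, rep (dclass Y (dsub D Y) p)) \<in> direl Z (dsub D Z)"
    using rep_dclass[OF assms(2)] by (rule direl_mono[OF assms(1) dsub_mono[OF assms(1)]])
  from dclass_eqI[OF this] show ?thesis by (simp add: incl_def path_mor_def)
qed

lemma fst_incl [simp]: "fst (incl D Z) x = x"
  by (simp add: incl_def)

lemma functor_incl:
  assumes X: "d_space X D" "Z \<subseteq> X" and "Y \<subseteq> Z" "A \<subseteq> Y" "A \<subseteq> B"
  shows "is_functor (fc D Y A) (fc D Z B) (incl D Z)"
  unfolding is_functor_def
proof (intro conjI ballI impI)
  have Y: "Y \<subseteq> X" using assms by auto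
  note i = incl_path_mor[OF \<open>Y \<subseteq> Z\<close>]
  fix f assume "f \<in> Mor (fc D Y A)"
  then obtain p where p: "f = path_mor D Y p" "p \<in> dsub D Y" "p 0 \<in> A" "p 1 \<in> A" by (rule Mor_fcE)
  moreover have pZ: "p \<in> dsub D Z" using p dsub_mono[OF \<open>Y \<subseteq> Z\<close>] by auto
  ultimately show "snd (incl D Z) f \<in> hom (fc D Z B) (fst (incl D Z) (Dom (fc D Y A) f)) (fst (incl D Z) (Cod (fc D Y A) f))"
    using \<open>A \<subseteq> B\<close> by (auto simp: i hom_def intro!: path_mor_in_Mor)
  fix g assume "g \<in> Mor (fc D Y A)" and e: "Cod (fc D Y A) f = Dom (fc D Y A) g"
  then obtain q where q: "g = path_mor D Y q" "q \<in> dsub D Y" "q 0 \<in> A" "q 1 \<in> A" by (metis Mor_fcE)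
  moreover have "q \<in> dsub D Z" using q dsub_mono[OF \<open>Y \<subseteq> Z\<close>] by auto
  moreover have "p +++ q \<in> dsub D Y"
    using p q e by (intro d_space_join[OF d_space_dsub[OF X(1) Y]]) auto
  ultimately show "snd (incl D Z) (Comp (fc D Y A) g f) = Comp (fc D Z B) (snd (incl D Z) g) (snd (incl D Z) f)"
    using p pZ e by (simp add: i Comp_path_mor[OF X] Comp_path_mor[OF X(1) Y])
next
  have "Y \<subseteq> X" using assms by auto
  fix x assume "x \<in> Obj (fc D Y A)"
  hence "(\<lambda>t. x) \<in> dsub D Y"
    using assms by (intro d_space_const[OF d_space_dsub[OF X(1) \<open>Y \<subseteq> X\<close>]]) auto
  thus "snd (incl D Z) (Id (fc D Y A) x) = Id (fc D Z B) (fst (incl D Z) x)"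
    by (simp add: incl_path_mor[OF \<open>Y \<subseteq> Z\<close>])
qed (use assms in auto)

lemma incl_incl:
  assumes "Y \<subseteq> Z" "Z \<subseteq> W" "f \<in> Mor (fc D Y A)"
  shows "snd (incl D W) (snd (incl D Z) f) = snd (incl D W) f"
proof -
  obtain p where p: "f = path_mor D Y p" "p \<in> dsub D Y" using assms(3) by (rule Mor_fcE)
  thus ?thesis using assms dsub_mono[OF \<open>Y \<subseteq> Z\<close>, of D] incl_path_mor[of Y W p D]
    by (auto simp: incl_path_mor[of Y Z] incl_path_mor[of Z W])
qed

section \<open>Retracts of pushouts of categories\<close>

lemma category_comp:
  assumes "category C" "f \<in> hom C x y" "g \<in> hom C y z" shows "Comp C g f \<in> hom C x z"
  using assms unfolding category_def hom_def by auto

lemma category_id_right: "category C \<Longrightarrow> f \<in> hom C x y \<Longrightarrow> Comp C f (Id C x) = f"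
  and category_id_left: "category C \<Longrightarrow> f \<in> hom C x y \<Longrightarrow> Comp C (Id C y) f = f"
  and category_id: "category C \<Longrightarrow> x' \<in> Obj C \<Longrightarrow> Id C x' \<in> hom C x' x'"
  and category_dom: "category C \<Longrightarrow> f \<in> hom C x y \<Longrightarrow> x \<in> Obj C"
  and category_cod: "category C \<Longrightarrow> f \<in> hom C x y \<Longrightarrow> y \<in> Obj C"
  unfolding category_def hom_def by auto

lemma category_assoc:
  assumes "category C" "f \<in> hom C x y" "g \<in> hom C y z" "h \<in> hom C z w"
  shows "Comp C h (Comp C g f) = Comp C (Comp C h g) f"
  using assms unfolding category_def hom_def by auto

lemma hom_Mor: "f \<in> hom C x y \<Longrightarrow> f \<in> Mor C \<and> Dom C f = x \<and> Cod C f = y"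
  and Mor_hom: "f \<in> Mor C \<Longrightarrow> f \<in> hom C (Dom C f) (Cod C f)"
  by (auto simp: hom_def)

lemma functor_obj: "is_functor C E F \<Longrightarrow> x \<in> Obj C \<Longrightarrow> fst F x \<in> Obj E"
  and functor_hom: "is_functor C E F \<Longrightarrow> f \<in> hom C x y \<Longrightarrow> snd F f \<in> hom E (fst F x) (fst F y)"
  and functor_id: "is_functor C E F \<Longrightarrow> x \<in> Obj C \<Longrightarrow> snd F (Id C x) = Id E (fst F x)"
  by (auto simp: is_functor_def hom_def)

lemma functor_comp:
  "is_functor C E F \<Longrightarrow> f \<in> hom C x y \<Longrightarrow> g \<in> hom C y z \<Longrightarrow> snd F (Comp C g f) = Comp E (snd F g) (snd F f)"
  by (auto simp: is_functor_def hom_def)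

lemma functor_fcomp:
  assumes F: "is_functor C E F" and G: "is_functor E K G"
  shows "is_functor C K (G \<circ>\<^sub>F F)"
  using assms unfolding is_functor_def fcomp_def hom_def by simp

lemma fcomp_apply [simp]: "fst (G \<circ>\<^sub>F F) x = fst G (fst F x)" "snd (G \<circ>\<^sub>F F) f = snd G (snd F f)"
  by (simp_all add: fcomp_def)

lemma fun_eq_onD:
  "fun_eq_on C F G \<Longrightarrow> x \<in> Obj C \<Longrightarrow> fst F x = fst G x"
  "fun_eq_on C F G \<Longrightarrow> f \<in> Mor C \<Longrightarrow> snd F f = snd G f"
  by (auto simp: fun_eq_on_def)

text \<open>The inclusion is the identity on morphisms and therefore never appears as a functor.
  This fits \<open>fc\<close> because its classes are formed in the ambient set, whatever the set of
  objects is.\<close>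

definition full_sub :: "('o, 'm) cat \<Rightarrow> ('o, 'm) cat \<Rightarrow> bool" where
  "full_sub B C \<longleftrightarrow> Obj B \<subseteq> Obj C \<and> Mor B = {f \<in> Mor C. Dom C f \<in> Obj B \<and> Cod C f \<in> Obj B} \<and>
     Dom B = Dom C \<and> Cod B = Cod C \<and> Id B = Id C \<and> Comp B = Comp C"

lemma full_sub_hom: "full_sub B C \<Longrightarrow> x \<in> Obj B \<Longrightarrow> y \<in> Obj B \<Longrightarrow> hom B x y = hom C x y"
  by (auto simp: full_sub_def hom_def)

lemma full_sub_hom_subset: "full_sub B C \<Longrightarrow> hom B x y \<subseteq> hom C x y"
  by (auto simp: full_sub_def hom_def)

text \<open>What remains of the adjunction when its unit or counit is forgotten. It has the same
  form for future and past retracts, and it is what the transfer of pushouts uses.\<close>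

definition cat_retraction :: "('o, 'm) cat \<Rightarrow> ('o, 'm) cat \<Rightarrow> ('o, 'm, 'o, 'm) ftr \<Rightarrow> bool" where
  "cat_retraction C B P \<longleftrightarrow> full_sub B C \<and> is_functor C B P \<and>
     (\<forall>x\<in>Obj B. fst P x = x) \<and> (\<forall>f\<in>Mor B. snd P f = f)"

text \<open>Naturality of the unit at a morphism of the subcategory says that \<open>P\<close> fixes it, because both
  components are identities.\<close>
lemma cat_retraction_of_unit:
  assumes C: "category C" and B: "full_sub B C" and P: "is_functor C B P"
    and unit: "\<And>b. b \<in> Obj C \<Longrightarrow> \<eta> b \<in> hom C b (fst P b)"
    and nat: "\<And>f. f \<in> Mor C \<Longrightarrow> Comp C (snd P f) (\<eta> (Dom C f)) = Comp C (\<eta> (Cod C f)) f"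
    and id: "\<And>a. a \<in> Obj B \<Longrightarrow> \<eta> a = Id C a"
  shows "cat_retraction C B P"
  unfolding cat_retraction_def
proof (intro conjI ballI B P)
  fix a assume a: "a \<in> Obj B"
  hence "a \<in> Obj C" using B by (auto simp: full_sub_def)
  thus P_a: "fst P a = a" using unit[of a] id[OF a] category_id[OF C, of a] by (auto simp: hom_def)
next
  fix f assume f: "f \<in> Mor B"
  hence f': "f \<in> Mor C" "Dom C f \<in> Obj B" "Cod C f \<in> Obj B" using B by (auto simp: full_sub_def)
  have P_a: "fst P a = a" if "a \<in> Obj B" for a
    using that B unit[of a] id[OF that] category_id[OF C, of a] by (auto simp: hom_def full_sub_def)
  have "snd P f \<in> hom C (Dom C f) (Cod C f)"
    using functor_hom[OF P Mor_hom[OF f'(1)]] full_sub_hom_subset[OF B] f' P_a by auto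
  thus "snd P f = f"
    using nat[OF f'(1)] id f' category_id_right[OF C] category_id_left[OF C] Mor_hom[OF f'(1)] by metis
qed

lemma future_retract_cat_retraction:
  assumes "category C" "full_sub B C" "future_retract C B P \<eta>"
  shows "cat_retraction C B P"
  using assms by (intro cat_retraction_of_unit[where \<eta> = \<eta>]) (auto simp: future_retract_def)

text \<open>This is the triangle identity for an adjunction whose counit is the identity. Naturality
  at \<open>\<eta> b\<close> itself shows that \<open>snd P (\<eta> b)\<close> factors
  \<open>\<eta> b\<close> through \<open>\<eta> b\<close>; so does the identity, and factorizations
  are unique.\<close>

lemma future_retract_unit:
  assumes C: "category C" and B: "full_sub B C" and P: "future_retract C B P \<eta>" and b: "b \<in> Obj C"
  shows "snd P (\<eta> b) = Id C (fst P b)"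
proof -
  have r: "is_functor C B P" "\<And>x. x \<in> Obj B \<Longrightarrow> fst P x = x"
    using future_retract_cat_retraction[OF C B P] by (auto simp: cat_retraction_def)
  have Pb: "fst P b \<in> Obj B" "fst P b \<in> Obj C"
    using functor_obj[OF r(1) b] B by (auto simp: full_sub_def)
  have eta: "\<eta> b \<in> hom C b (fst P b)" using P b by (auto simp: future_retract_def)
  have ex: "\<exists>!g. g \<in> hom B (fst P b) (fst P b) \<and> Comp C g (\<eta> b) = \<eta> b"
    using P b Pb eta by (auto simp: future_retract_def)
  have "Comp C (snd P (\<eta> b)) (\<eta> b) = Comp C (\<eta> (fst P b)) (\<eta> b)"
    using P eta by (auto simp: future_retract_def hom_def)
  also have "\<eta> (fst P b) = Id C (fst P b)" using P Pb by (auto simp: future_retract_def)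
  also have "Comp C (Id C (fst P b)) (\<eta> b) = \<eta> b" using C eta by (rule category_id_left)
  finally have "Comp C (snd P (\<eta> b)) (\<eta> b) = \<eta> b" .
  moreover have "snd P (\<eta> b) \<in> hom B (fst P b) (fst P b)"
    using functor_hom[OF r(1) eta] r(2)[OF Pb(1)] by simp
  moreover have "Id C (fst P b) \<in> hom B (fst P b) (fst P b)"
    using category_id[OF C Pb(2)] full_sub_hom[OF B Pb(1) Pb(1)] by simp
  moreover have "Comp C (Id C (fst P b)) (\<eta> b) = \<eta> b" using C eta by (rule category_id_left)
  ultimately show ?thesis using ex by blast
qed

section \<open>Generating sets of morphisms and the gluing of retracts\<close>

inductive_set gen :: "('o, 'm) cat \<Rightarrow> 'm set \<Rightarrow> 'm set" for C S where
  gen_base: "f \<in> S \<Longrightarrow> f \<in> gen C S"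
| gen_comp: "f \<in> gen C S \<Longrightarrow> g \<in> gen C S \<Longrightarrow> f \<in> Mor C \<Longrightarrow> g \<in> Mor C \<Longrightarrow> Cod C f = Dom C g \<Longrightarrow>
    Comp C g f \<in> gen C S"

text \<open>Words in generators go to words in their images. Applied to a retraction, this passes
  generation on to the subcategory.\<close>

lemma gen_functor:
  assumes "f \<in> gen C S" and F: "is_functor C B F" and S: "\<And>s. s \<in> S \<Longrightarrow> snd F s \<in> gen B T"
  shows "snd F f \<in> gen B T"
  using assms(1)
proof induction
  case (gen_comp f g)
  have f: "f \<in> hom C (Dom C f) (Dom C g)" and g: "g \<in> hom C (Dom C g) (Cod C g)"
    using gen_comp by (auto simp: hom_def)
  show ?case
    unfolding functor_comp[OF F f g]
    using functor_hom[OF F f] functor_hom[OF F g] gen_comp.IH by (auto simp: hom_def intro!: gen.gen_comp)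
qed (rule S)

text \<open>What gluing uses about the spaces, in a form symmetric in the parts and stable under
  reversal of arrows. In the application \<open>Ck\<close> is level \<open>l - 1\<close> over part
  \<open>k\<close> and \<open>Bk\<close> is level \<open>l\<close>; \<open>C\<close> and
  \<open>B\<close> are their counterparts over the whole space.\<close>

locale cocone =
  fixes K :: "'k set" and Ck Bk :: "'k \<Rightarrow> ('o, 'm) cat" and C B :: "('o, 'm) cat"
    and G P :: "'k \<Rightarrow> ('o, 'm, 'o, 'm) ftr" and Q :: "('o, 'm, 'o, 'm) ftr"
  assumes C: "category C" and Ck: "\<And>k. k \<in> K \<Longrightarrow> category (Ck k)"
    and B: "full_sub B C" and Bk: "\<And>k. k \<in> K \<Longrightarrow> full_sub (Bk k) (Ck k)"
    and G: "\<And>k. k \<in> K \<Longrightarrow> is_functor (Ck k) C (G k)"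
    and G_obj: "\<And>k x. k \<in> K \<Longrightarrow> x \<in> Obj (Ck k) \<Longrightarrow> fst (G k) x = x"
    and Obj_C: "Obj C = (\<Union>k\<in>K. Obj (Ck k))" and Obj_B: "Obj B = (\<Union>k\<in>K. Obj (Bk k))"
    and gen_C: "Mor C \<subseteq> gen C (\<Union>k\<in>K. snd (G k) ` Mor (Ck k))"
    and Q: "is_functor C B Q"
    and QG: "\<And>k. k \<in> K \<Longrightarrow> fun_eq_on (Ck k) (Q \<circ>\<^sub>F G k) (G k \<circ>\<^sub>F P k)"
begin

text \<open>\<open>Q\<close> fixes a morphism of \<open>B\<close>, while it turns each of its
  factors in \<open>C\<close>, which comes from some \<open>Ck\<close>, into one that comes from
  \<open>Bk\<close>.\<close>

lemma gen_B:
  assumes r: "cat_retraction C B Q" and P: "\<And>k. k \<in> K \<Longrightarrow> is_functor (Ck k) (Bk k) (P k)"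
  shows "Mor B \<subseteq> gen B (\<Union>k\<in>K. snd (G k) ` Mor (Bk k))"
proof
  fix f assume f: "f \<in> Mor B"
  hence "f \<in> gen C (\<Union>k\<in>K. snd (G k) ` Mor (Ck k))" using gen_C B by (auto simp: full_sub_def)
  hence "snd Q f \<in> gen B (\<Union>k\<in>K. snd (G k) ` Mor (Bk k))"
  proof (rule gen_functor[OF _ Q])
    fix s assume "s \<in> (\<Union>k\<in>K. snd (G k) ` Mor (Ck k))"
    then obtain k h where k: "k \<in> K" and h: "h \<in> Mor (Ck k)" "s = snd (G k) h" by auto
    have "snd Q s = snd (G k) (snd (P k) h)" using fun_eq_onD(2)[OF QG[OF k] h(1)] h(2) by simp
    moreover have "snd (P k) h \<in> Mor (Bk k)"
      using functor_hom[OF P[OF k] Mor_hom[OF h(1)]] by (auto simp: hom_def)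
    ultimately show "snd Q s \<in> gen B (\<Union>k\<in>K. snd (G k) ` Mor (Bk k))" using k by (auto intro!: gen_base)
  qed
  thus "f \<in> gen B (\<Union>k\<in>K. snd (G k) ` Mor (Bk k))" using r f by (simp add: cat_retraction_def)
qed

text \<open>The unit is transported from the parts, and its naturality spreads from generators to
  composites. The universal properties of the parts enter through the triangle identity, which
  yields \<open>Qv\<close>.\<close>

lemma future_retract_glue:
  assumes P: "\<And>k. k \<in> K \<Longrightarrow> future_retract (Ck k) (Bk k) (P k) (\<eta> k)"
    and overlap: "\<And>k k' x. k \<in> K \<Longrightarrow> k' \<in> K \<Longrightarrow> x \<in> Obj (Ck k) \<Longrightarrow> x \<in> Obj (Ck k') \<Longrightarrow>
       snd (G k) (\<eta> k x) = snd (G k') (\<eta> k' x)"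
  shows "\<exists>v. future_retract C B Q v"
proof -
  \<comment> \<open>The choice of \<open>k\<close> is immaterial by \<open>overlap\<close>.\<close>
  define v where "v x = (let k = (SOME k. k \<in> K \<and> x \<in> Obj (Ck k)) in snd (G k) (\<eta> k x))" for x
  have v: "v x = snd (G k) (\<eta> k x)" if "k \<in> K" "x \<in> Obj (Ck k)" for k x
  proof -
    have "(SOME k. k \<in> K \<and> x \<in> Obj (Ck k)) \<in> K \<and> x \<in> Obj (Ck (SOME k. k \<in> K \<and> x \<in> Obj (Ck k)))"
      by (rule someI[of _ k]) (use that in auto)
    thus ?thesis unfolding v_def Let_def using overlap that by blast
  qed
  have eta: "\<eta> k x \<in> hom (Ck k) x (fst (P k) x)" if "k \<in> K" "x \<in> Obj (Ck k)" for k x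
    using P that by (auto simp: future_retract_def)
  have ret: "cat_retraction (Ck k) (Bk k) (P k)" if "k \<in> K" for k
    using future_retract_cat_retraction[OF Ck Bk P] that by blast
  have P_fun: "is_functor (Ck k) (Bk k) (P k)" if "k \<in> K" for k
    using ret[OF that] by (simp add: cat_retraction_def)
  have P_obj: "fst (P k) x \<in> Obj (Ck k)" if "k \<in> K" "x \<in> Obj (Ck k)" for k x
    using functor_obj[OF P_fun[OF that(1)] that(2)] Bk[OF that(1)] by (auto simp: full_sub_def)
  have Q_obj: "fst Q x = fst (P k) x" if "k \<in> K" "x \<in> Obj (Ck k)" for k x
    using fun_eq_onD(1)[OF QG that(2)] G_obj P_obj that by simp
  have unit: "v b \<in> hom C b (fst Q b)" if b: "b \<in> Obj C" for b
  proof -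
    from b obtain k where k: "k \<in> K" "b \<in> Obj (Ck k)" using Obj_C by auto
    show ?thesis
      using functor_hom[OF G eta[OF k]] k G_obj P_obj[OF k] Q_obj[OF k] v[OF k] by simp
  qed
  have nat: "Comp C (snd Q f) (v (Dom C f)) = Comp C (v (Cod C f)) f" if f: "f \<in> Mor C" for f
  proof -
    from f gen_C have "f \<in> gen C (\<Union>k\<in>K. snd (G k) ` Mor (Ck k))" by auto
    thus ?thesis
    proof induction
      case (gen_base f)
      then obtain k h where k: "k \<in> K" and h: "h \<in> Mor (Ck k)" "f = snd (G k) h" by auto
      let ?x = "Dom (Ck k) h" and ?y = "Cod (Ck k) h"
      note hh = Mor_hom[OF h(1)]
      have xy: "?x \<in> Obj (Ck k)" "?y \<in> Obj (Ck k)"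
        using category_dom[OF Ck[OF k] hh] category_cod[OF Ck[OF k] hh] .
      have dc: "Dom C f = ?x" "Cod C f = ?y"
        using functor_hom[OF G[OF k] hh] h(2) G_obj[OF k] xy by (auto simp: hom_def)
      have Ph: "snd (P k) h \<in> hom (Ck k) (fst (P k) ?x) (fst (P k) ?y)"
        using functor_hom[OF P_fun[OF k] hh] full_sub_hom_subset[OF Bk[OF k]] by auto
      have "Comp C (snd Q f) (v ?x) = Comp C (snd (G k) (snd (P k) h)) (snd (G k) (\<eta> k ?x))"
        using fun_eq_onD(2)[OF QG[OF k] h(1)] h(2) v[OF k xy(1)] by simp
      also have "\<dots> = snd (G k) (Comp (Ck k) (snd (P k) h) (\<eta> k ?x))"
        using functor_comp[OF G[OF k] eta[OF k xy(1)] Ph] by simp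
      also have "Comp (Ck k) (snd (P k) h) (\<eta> k ?x) = Comp (Ck k) (\<eta> k ?y) h"
        using P[OF k] h(1) by (auto simp: future_retract_def)
      also have "snd (G k) \<dots> = Comp C (v ?y) f"
        using functor_comp[OF G[OF k] hh eta[OF k xy(2)]] v[OF k xy(2)] h(2) by simp
      finally show ?case using dc by simp
    next
      case (gen_comp f g)
      let ?x = "Dom C f" and ?y = "Dom C g" and ?z = "Cod C g"
      have f: "f \<in> hom C ?x ?y" and g: "g \<in> hom C ?y ?z" using gen_comp by (auto simp: hom_def)
      have obj: "?x \<in> Obj C" "?y \<in> Obj C" "?z \<in> Obj C"
        using category_dom[OF C f] category_dom[OF C g] category_cod[OF C g] .
      have Qf: "snd Q f \<in> hom C (fst Q ?x) (fst Q ?y)" and Qg: "snd Q g \<in> hom C (fst Q ?y) (fst Q ?z)"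
        using functor_hom[OF Q f] functor_hom[OF Q g] full_sub_hom_subset[OF B] by auto
      have "Comp C (snd Q (Comp C g f)) (v ?x) = Comp C (Comp C (snd Q g) (snd Q f)) (v ?x)"
        using functor_comp[OF Q f g] B by (simp add: full_sub_def)
      also have "\<dots> = Comp C (snd Q g) (Comp C (snd Q f) (v ?x))"
        by (rule category_assoc[OF C unit[OF obj(1)] Qf Qg, symmetric])
      also have "\<dots> = Comp C (snd Q g) (Comp C (v ?y) f)" using gen_comp by simp
      also have "\<dots> = Comp C (Comp C (snd Q g) (v ?y)) f" by (rule category_assoc[OF C f unit[OF obj(2)] Qg])
      also have "\<dots> = Comp C (Comp C (v ?z) g) f" using gen_comp by simp
      also have "\<dots> = Comp C (v ?z) (Comp C g f)" by (rule category_assoc[OF C f g unit[OF obj(3)], symmetric])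
      finally show ?case using hom_Mor[OF category_comp[OF C f g]] by simp
    qed
  qed
  have id: "v a = Id C a" if a: "a \<in> Obj B" for a
  proof -
    from a obtain k where k: "k \<in> K" "a \<in> Obj (Bk k)" using Obj_B by auto
    hence a': "a \<in> Obj (Ck k)" using Bk[OF k(1)] by (auto simp: full_sub_def)
    have "\<eta> k a = Id (Ck k) a" using P[OF k(1)] k(2) by (simp add: future_retract_def)
    thus ?thesis using v[OF k(1) a'] functor_id[OF G[OF k(1)] a'] G_obj[OF k(1) a'] by simp
  qed
  \<comment> \<open>Naturality at morphisms of \<open>B\<close> makes \<open>Q\<close> a retraction
    before anything is known about universality.\<close>
  have rQ: "\<And>x. x \<in> Obj B \<Longrightarrow> fst Q x = x" "\<And>f. f \<in> Mor B \<Longrightarrow> snd Q f = f"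
    using cat_retraction_of_unit[OF C B Q unit nat id] by (auto simp: cat_retraction_def)
  have Qv: "snd Q (v b) = Id C (fst Q b)" if b: "b \<in> Obj C" for b
  proof -
    from b obtain k where k: "k \<in> K" "b \<in> Obj (Ck k)" using Obj_C by auto
    have "snd Q (v b) = snd (G k) (snd (P k) (\<eta> k b))"
      using fun_eq_onD(2)[OF QG[OF k(1)], of "\<eta> k b"] v[OF k] hom_Mor[OF eta[OF k]] by simp
    also have "\<dots> = snd (G k) (Id (Ck k) (fst (P k) b))"
      using future_retract_unit[OF Ck Bk P] k by simp
    also have "\<dots> = Id C (fst Q b)"
      using functor_id[OF G[OF k(1)] P_obj[OF k]] G_obj[OF k(1) P_obj[OF k]] Q_obj[OF k] by simp
    finally show ?thesis .
  qed
  \<comment> \<open>By naturality \<open>snd Q f\<close> is a factorization. It is the only one: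
    applying \<open>Q\<close> to \<open>Comp C g (v b) = f\<close> turns \<open>v b\<close> into an
    identity and fixes \<open>g\<close>.\<close>
  have univ: "\<exists>!g. g \<in> hom B (fst Q b) a \<and> Comp C g (v b) = f"
    if b: "b \<in> Obj C" and a: "a \<in> Obj B" and f: "f \<in> hom C b a" for b a f
  proof (rule ex1I[of _ "snd Q f"], intro conjI)
    show "snd Q f \<in> hom B (fst Q b) a" using functor_hom[OF Q f] rQ(1)[OF a] by simp
    show "Comp C (snd Q f) (v b) = f"
      using nat[of f] id[OF a] category_id_left[OF C f] hom_Mor[OF f] by simp
    fix g assume g: "g \<in> hom B (fst Q b) a \<and> Comp C g (v b) = f"
    have gC: "g \<in> hom C (fst Q b) a" using g full_sub_hom_subset[OF B] by auto
    have "snd Q f = Comp B (snd Q g) (snd Q (v b))" using functor_comp[OF Q unit[OF b] gC] g by simp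
    also have "\<dots> = Comp C g (Id C (fst Q b))" 
      using rQ(2)[of g] hom_Mor[OF conjunct1[OF g]] Qv[OF b] B by (simp add: full_sub_def)
    also have "\<dots> = g" using category_id_right[OF C gC] .
    finally show "g = snd Q f" by simp
  qed
  show ?thesis
    unfolding future_retract_def using Q unit nat univ id by blast
qed

end

section \<open>Duality between future and past retracts\<close>

definition opcat :: "('o, 'm) cat \<Rightarrow> ('o, 'm) cat" where
  "opcat C = \<lparr>Obj = Obj C, Mor = Mor C, Dom = Cod C, Cod = Dom C, Id = Id C, Comp = (\<lambda>g f. Comp C f g)\<rparr>"

lemma opcat_simps [simp]:
  "Obj (opcat C) = Obj C" "Mor (opcat C) = Mor C" "Dom (opcat C) = Cod C" "Cod (opcat C) = Dom C"
  "Id (opcat C) = Id C" "Comp (opcat C) g f = Comp C f g" "hom (opcat C) x y = hom C y x"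
  by (auto simp: opcat_def hom_def)

lemma category_opcat: "category C \<Longrightarrow> category (opcat C)"
  unfolding category_def by auto

lemma functor_opcat: "is_functor C E F \<Longrightarrow> is_functor (opcat C) (opcat E) F"
  unfolding is_functor_def by auto

lemma full_sub_opcat: "full_sub B C \<Longrightarrow> full_sub (opcat B) (opcat C)"
  unfolding full_sub_def opcat_def by auto

lemma gen_opcat: "f \<in> gen C S \<Longrightarrow> f \<in> gen (opcat C) S"
proof (induction rule: gen.induct)
  case (gen_comp f g)
  thus ?case using gen.gen_comp[of g "opcat C" S f] by simp
qed (rule gen_base)

text \<open>Reversing arrows exchanges unit and counit, while the functor stays the same; this
  spares a second gluing argument.\<close>

lemma past_retract_opcat: "future_retract (opcat C) (opcat B) P u \<longleftrightarrow> past_retract C B P u"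
  unfolding future_retract_def past_retract_def is_functor_def
  by (auto; metis)

lemma (in cocone) cocone_opcat: "cocone K (\<lambda>k. opcat (Ck k)) (\<lambda>k. opcat (Bk k)) (opcat C) (opcat B) G P Q"
proof
  show "Mor (opcat C) \<subseteq> gen (opcat C) (\<Union>k\<in>K. snd (G k) ` Mor (opcat (Ck k)))"
    using gen_C by (auto intro: gen_opcat)
qed (use C Ck B Bk G G_obj Obj_C Obj_B Q QG in
      \<open>auto intro: category_opcat functor_opcat full_sub_opcat simp: fun_eq_on_def\<close>)

lemma retract_cat_retraction:
  assumes "category C" "full_sub B C" "retract fut C B P u"
  shows "cat_retraction C B P"
proof (cases fut)
  case False
  hence "cat_retraction (opcat C) (opcat B) P"
    using assms by (intro future_retract_cat_retraction[where \<eta> = u] category_opcat full_sub_opcat)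
      (auto simp: past_retract_opcat retract_def)
  moreover have "is_functor C B P"
    using assms(3) False by (simp add: retract_def past_retract_def)
  ultimately show ?thesis using assms by (simp add: cat_retraction_def)
qed (use assms in \<open>auto simp: retract_def intro: future_retract_cat_retraction\<close>)

lemma (in cocone) retract_glue:
  assumes P: "\<And>k. k \<in> K \<Longrightarrow> retract fut (Ck k) (Bk k) (P k) (\<eta> k)"
    and overlap: "\<And>k k' x. k \<in> K \<Longrightarrow> k' \<in> K \<Longrightarrow> x \<in> Obj (Ck k) \<Longrightarrow> x \<in> Obj (Ck k') \<Longrightarrow>
       snd (G k) (\<eta> k x) = snd (G k') (\<eta> k' x)"
  shows "\<exists>v. retract fut C B Q v"
proof (cases fut)
  case True
  hence "future_retract (Ck k) (Bk k) (P k) (\<eta> k)" if "k \<in> K" for k using P[OF that] by (simp add: retract_def)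
  from future_retract_glue[OF this overlap] show ?thesis using True by (simp add: retract_def)
next
  case False
  interpret op: cocone K "\<lambda>k. opcat (Ck k)" "\<lambda>k. opcat (Bk k)" "opcat C" "opcat B" G P Q
    by (rule cocone_opcat)
  have "future_retract (opcat (Ck k)) (opcat (Bk k)) (P k) (\<eta> k)" if "k \<in> K" for k
    using P[OF that] False by (simp add: retract_def past_retract_opcat)
  from op.future_retract_glue[OF this, unfolded opcat_simps, OF _ overlap] show ?thesis
    using False by (simp add: retract_def past_retract_opcat)
qed

section \<open>Transfer of the pushout property to a retract\<close>

lemma pushout_universal:
  fixes E :: "('oe, 'me) cat"
  assumes "is_pushout TYPE(('oe, 'me) cat) C0 C1 C2 C F1 F2 G1 G2" "category E"
    "is_functor C1 E H1" "is_functor C2 E H2" "fun_eq_on C0 (H1 \<circ>\<^sub>F F1) (H2 \<circ>\<^sub>F F2)"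
  obtains H :: "('o, 'm, 'oe, 'me) ftr" where "is_functor C E H" "fun_eq_on C1 (H \<circ>\<^sub>F G1) H1" "fun_eq_on C2 (H \<circ>\<^sub>F G2) H2"
    "\<And>H'. is_functor C E H' \<Longrightarrow> fun_eq_on C1 (H' \<circ>\<^sub>F G1) H1 \<Longrightarrow> fun_eq_on C2 (H' \<circ>\<^sub>F G2) H2 \<Longrightarrow> fun_eq_on C H H'"
proof -
  have "\<exists>H. is_functor C E H \<and> fun_eq_on C1 (H \<circ>\<^sub>F G1) H1 \<and> fun_eq_on C2 (H \<circ>\<^sub>F G2) H2 \<and>
      (\<forall>H'. is_functor C E H' \<and> fun_eq_on C1 (H' \<circ>\<^sub>F G1) H1 \<and> fun_eq_on C2 (H' \<circ>\<^sub>F G2) H2 \<longrightarrow> fun_eq_on C H H')"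
    using assms(1)[unfolded is_pushout_def] assms(2-) by (simp del: split_paired_All split_paired_Ex)
  thus ?thesis using that by blast
qed

text \<open>The argument that a retract of a colimit diagram is a colimit diagram: cocones are
  pulled back along the retractions, and mediating functors are restricted to
  \<open>B\<close>.\<close>

lemma pushout_retract:
  assumes po: "is_pushout TYPE(('oe, 'me) cat) C0 C1 C2 C F1 F2 G1 G2"
    and cat: "category B0" "category B1" "category B2" "category B"
    and F: "is_functor B0 B1 F1" "is_functor B0 B2 F2" and G: "is_functor B1 B G1" "is_functor B2 B G2"
    and ret: "cat_retraction C0 B0 P0" "cat_retraction C1 B1 P1" "cat_retraction C2 B2 P2" "cat_retraction C B Q"
    and PF: "fun_eq_on C0 (P1 \<circ>\<^sub>F F1) (F1 \<circ>\<^sub>F P0)" "fun_eq_on C0 (P2 \<circ>\<^sub>F F2) (F2 \<circ>\<^sub>F P0)"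
    and QG: "fun_eq_on C1 (Q \<circ>\<^sub>F G1) (G1 \<circ>\<^sub>F P1)" "fun_eq_on C2 (Q \<circ>\<^sub>F G2) (G2 \<circ>\<^sub>F P2)"
  shows "is_pushout TYPE(('oe, 'me) cat) B0 B1 B2 B F1 F2 G1 G2"
proof -
  have sub: "full_sub B0 C0" "full_sub B1 C1" "full_sub B2 C2" "full_sub B C"
    and P: "is_functor C0 B0 P0" "is_functor C1 B1 P1" "is_functor C2 B2 P2" "is_functor C B Q"
    using ret by (auto simp: cat_retraction_def)
  have comm: "fun_eq_on C0 (G1 \<circ>\<^sub>F F1) (G2 \<circ>\<^sub>F F2)" using po by (simp add: is_pushout_def)
  have P_mem: "\<And>x. x \<in> Obj C0 \<Longrightarrow> fst P0 x \<in> Obj B0" "\<And>f. f \<in> Mor C0 \<Longrightarrow> snd P0 f \<in> Mor B0"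
    "\<And>x. x \<in> Obj C1 \<Longrightarrow> fst P1 x \<in> Obj B1" "\<And>f. f \<in> Mor C1 \<Longrightarrow> snd P1 f \<in> Mor B1"
    "\<And>x. x \<in> Obj C2 \<Longrightarrow> fst P2 x \<in> Obj B2" "\<And>f. f \<in> Mor C2 \<Longrightarrow> snd P2 f \<in> Mor B2"
    using P by (auto simp: is_functor_def hom_def)
  have B_sub: "Obj B0 \<subseteq> Obj C0" "Mor B0 \<subseteq> Mor C0" "Obj B1 \<subseteq> Obj C1" "Mor B1 \<subseteq> Mor C1"
    "Obj B2 \<subseteq> Obj C2" "Mor B2 \<subseteq> Mor C2" "Obj B \<subseteq> Obj C" "Mor B \<subseteq> Mor C"
    using sub by (auto simp: full_sub_def)
  have fixed: "\<And>x. x \<in> Obj B1 \<Longrightarrow> fst P1 x = x" "\<And>f. f \<in> Mor B1 \<Longrightarrow> snd P1 f = f"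
    "\<And>x. x \<in> Obj B2 \<Longrightarrow> fst P2 x = x" "\<And>f. f \<in> Mor B2 \<Longrightarrow> snd P2 f = f"
    "\<And>x. x \<in> Obj B \<Longrightarrow> fst Q x = x" "\<And>f. f \<in> Mor B \<Longrightarrow> snd Q f = f"
    using ret by (auto simp: cat_retraction_def)
  show ?thesis
    unfolding is_pushout_def
  proof (intro conjI allI impI cat F G)
    show "fun_eq_on B0 (G1 \<circ>\<^sub>F F1) (G2 \<circ>\<^sub>F F2)"
      using comm B_sub unfolding fun_eq_on_def by blast
  next
    fix E :: "('oe, 'me) cat" and H1 H2
    assume "category E \<and> is_functor B1 E H1 \<and> is_functor B2 E H2 \<and> fun_eq_on B0 (H1 \<circ>\<^sub>F F1) (H2 \<circ>\<^sub>F F2)"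
    hence E: "category E" and H12: "is_functor B1 E H1" "is_functor B2 E H2"
      and eq: "fun_eq_on B0 (H1 \<circ>\<^sub>F F1) (H2 \<circ>\<^sub>F F2)" by auto
    \<comment> \<open>Precomposition with the retractions turns a cocone on the small square into
      one on the large square.\<close>
    have "fun_eq_on C0 ((H1 \<circ>\<^sub>F P1) \<circ>\<^sub>F F1) ((H2 \<circ>\<^sub>F P2) \<circ>\<^sub>F F2)"
      using eq PF P_mem unfolding fun_eq_on_def by simp
    then obtain H where H: "is_functor C E H" "fun_eq_on C1 (H \<circ>\<^sub>F G1) (H1 \<circ>\<^sub>F P1)"
        "fun_eq_on C2 (H \<circ>\<^sub>F G2) (H2 \<circ>\<^sub>F P2)"
      and uniq: "\<And>H'. is_functor C E H' \<Longrightarrow> fun_eq_on C1 (H' \<circ>\<^sub>F G1) (H1 \<circ>\<^sub>F P1) \<Longrightarrow>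
        fun_eq_on C2 (H' \<circ>\<^sub>F G2) (H2 \<circ>\<^sub>F P2) \<Longrightarrow> fun_eq_on C H H'"
      by (rule pushout_universal[OF po E functor_fcomp[OF P(2) H12(1)] functor_fcomp[OF P(3) H12(2)]]) blast
    have "is_functor B E H"
      using H(1) sub(4) unfolding is_functor_def full_sub_def by auto
    moreover have "fun_eq_on B1 (H \<circ>\<^sub>F G1) H1"
      unfolding fun_eq_on_def
    proof (intro conjI ballI)
      fix x assume "x \<in> Obj B1" thus "fst (H \<circ>\<^sub>F G1) x = fst H1 x"
        using fun_eq_onD(1)[OF H(2), of x] fixed(1) B_sub by auto
    next
      fix f assume "f \<in> Mor B1" thus "snd (H \<circ>\<^sub>F G1) f = snd H1 f"
        using fun_eq_onD(2)[OF H(2), of f] fixed(2) B_sub by auto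
    qed
    moreover have "fun_eq_on B2 (H \<circ>\<^sub>F G2) H2"
      unfolding fun_eq_on_def
    proof (intro conjI ballI)
      fix x assume "x \<in> Obj B2" thus "fst (H \<circ>\<^sub>F G2) x = fst H2 x"
        using fun_eq_onD(1)[OF H(3), of x] fixed(3) B_sub by auto
    next
      fix f assume "f \<in> Mor B2" thus "snd (H \<circ>\<^sub>F G2) f = snd H2 f"
        using fun_eq_onD(2)[OF H(3), of f] fixed(4) B_sub by auto
    qed
    moreover have "fun_eq_on B H K"
      if K: "is_functor B E K" "fun_eq_on B1 (K \<circ>\<^sub>F G1) H1" "fun_eq_on B2 (K \<circ>\<^sub>F G2) H2" for K
    proof -
      \<comment> \<open>A competitor on \<open>B\<close> is extended to \<open>C\<close> by means of
        \<open>Q\<close>, and uniqueness is known there; on \<open>B\<close> itself \<open>Q\<close>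
        acts as the identity.\<close>
      have "fun_eq_on C H (K \<circ>\<^sub>F Q)"
      proof (rule uniq)
        show "is_functor C E (K \<circ>\<^sub>F Q)" by (rule functor_fcomp[OF P(4) K(1)])
        show "fun_eq_on C1 (K \<circ>\<^sub>F Q \<circ>\<^sub>F G1) (H1 \<circ>\<^sub>F P1)" "fun_eq_on C2 (K \<circ>\<^sub>F Q \<circ>\<^sub>F G2) (H2 \<circ>\<^sub>F P2)"
          using K(2,3) QG P_mem unfolding fun_eq_on_def by simp_all
      qed
      thus ?thesis using fixed(5,6) B_sub(7,8) unfolding fun_eq_on_def by (metis fcomp_apply subsetD)
    qed
    ultimately show "\<exists>H. is_functor B E H \<and> fun_eq_on B1 (H \<circ>\<^sub>F G1) H1 \<and> fun_eq_on B2 (H \<circ>\<^sub>F G2) H2 \<and>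
      (\<forall>H'. is_functor B E H' \<and> fun_eq_on B1 (H' \<circ>\<^sub>F G1) H1 \<and> fun_eq_on B2 (H' \<circ>\<^sub>F G2) H2 \<longrightarrow> fun_eq_on B H H')"
      by blast
  qed
qed

section \<open>The van Kampen theorem for fundamental categories\<close>

locale d_cover =
  fixes X :: "'a::topological_space set" and D :: "(real \<Rightarrow> 'a) set" and K :: "'k set" and Y :: "'k \<Rightarrow> 'a set"
  assumes X: "d_space X D" and YX: "\<And>k. k \<in> K \<Longrightarrow> Y k \<subseteq> X"
    and cover: "X = (\<Union>k\<in>K. top_of_set X interior_of Y k)"
begin

lemma cover_open:
  assumes "x \<in> X"
  obtains k U where "k \<in> K" "openin (top_of_set X) U" "x \<in> U" "U \<subseteq> Y k"
proof -
  from assms cover obtain k where "k \<in> K" "x \<in> top_of_set X interior_of Y k" by blast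
  thus ?thesis using that by (auto simp: interior_of_def)
qed

lemma cover_mem: "x \<in> X \<Longrightarrow> \<exists>k\<in>K. x \<in> Y k"
  using cover_open[of x] by blast

text \<open>The local statement behind a Lebesgue number. The domain is a general metric space so
  that both the unit interval and the unit square are served.\<close>

lemma cover_local:
  fixes g :: "'b::metric_space \<Rightarrow> 'a"
  assumes "continuous_on S g" "g ` S \<subseteq> X" "x \<in> S"
  obtains k e where "k \<in> K" "e > 0" "g ` (ball x e \<inter> S) \<subseteq> Y k"
proof -
  obtain k U where k: "k \<in> K" and U: "openin (top_of_set X) U" "g x \<in> U" "U \<subseteq> Y k"
    using cover_open[of "g x"] assms by blast
  have "openin (top_of_set S) (S \<inter> g -` U)"
    using assms U by (intro continuous_openin_preimage) auto
  then obtain e where "e > 0" "ball x e \<inter> S \<subseteq> S \<inter> g -` U"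
    using assms(3) U(2) unfolding openin_contains_ball by blast
  thus ?thesis using that[OF k, of e] U(3) by blast
qed

text \<open>Bisection stands in for a finite subdivision: each time has a neighbourhood mapped into
  one part, and a property that adds up over adjacent intervals spreads from small intervals to
  all.\<close>

lemma path_piece_induct:
  assumes p: "p \<in> D" and ab: "0 \<le> a" "a \<le> b" "b \<le> 1"
    and piece: "\<And>k a b. k \<in> K \<Longrightarrow> 0 \<le> a \<Longrightarrow> a \<le> b \<Longrightarrow> b \<le> 1 \<Longrightarrow> p ` {a..b} \<subseteq> Y k \<Longrightarrow> R a b"
    and join: "\<And>a b c. 0 \<le> a \<Longrightarrow> a \<le> b \<Longrightarrow> b \<le> c \<Longrightarrow> c \<le> 1 \<Longrightarrow> R a b \<Longrightarrow> R b c \<Longrightarrow> R a c"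
  shows "R a b"
proof -
  \<comment> \<open>Small intervals around a point may stick out of the given one; the two
    implications restrict the property to those inside.\<close>
  have "a \<le> a \<longrightarrow> b \<le> b \<longrightarrow> R a b"
  proof (induction rule: Bolzano[where P = "\<lambda>c d. a \<le> c \<longrightarrow> d \<le> b \<longrightarrow> R c d", OF ab(2)])
    case (1 c d e)
    thus ?case using join[of c d e] ab by auto
  next
    case (2 x)
    obtain k e where k: "k \<in> K" "e > 0" "p ` (ball x e \<inter> {0..1}) \<subseteq> Y k"
      using cover_local[OF d_space_continuous[OF X p] d_space_image[OF X p], of x] 2 ab by auto
    have "R c d" if "c \<le> x" "x \<le> d" "d - c < e" "a \<le> c" "d \<le> b" for c d
    proof (rule piece[OF k(1)])
      have "{c..d} \<subseteq> ball x e \<inter> {0..1}" using that ab by (auto simp: dist_real_def)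
      thus "p ` {c..d} \<subseteq> Y k" using k(3) by blast
    qed (use that ab in auto)
    thus ?case using k(2) by blast
  qed
  thus ?thesis by simp
qed

lemma piece_mem:
  assumes "p \<in> D" "0 \<le> a" "a \<le> b" "b \<le> 1" "p ` {a..b} \<subseteq> Y k"
  shows "subdipath a b p \<in> dsub D (Y k)"
  using assms subdipath_in_d_space[OF X assms(1-4)] by (simp add: dsub_def subdipath_image_interval)

text \<open>Concatenations of subpaths become composites of morphisms, so
  \<open>path_piece_induct\<close> turns subdivision into algebraic generation.\<close>

lemma gen_fc: "Mor (fc D X X) \<subseteq> gen (fc D X X) (\<Union>k\<in>K. snd (incl D X) ` Mor (fc D (Y k) (Y k)))"
  (is "_ \<subseteq> ?G")
proof
  fix f assume "f \<in> Mor (fc D X X)"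
  then obtain p where f: "f = path_mor D X p" and p: "p \<in> D" by (auto simp: Mor_fc dsub_def)
  have mem: "subdipath a b p \<in> dsub D X" if "0 \<le> a" "a \<le> b" "b \<le> 1" for a b
    using subdipath_in_d_space[OF X p that] by (simp add: dsub_whole[OF X])
  have X': "d_space X (dsub D X)" using X by (simp add: dsub_whole)
  have "path_mor D X (subdipath 0 1 p) \<in> ?G"
  proof (rule path_piece_induct[OF p])
    fix k a b assume k: "k \<in> K" and ab: "0 \<le> a" "a \<le> b" "b \<le> (1::real)" and pk: "p ` {a..b} \<subseteq> Y k"
    note m = piece_mem[OF p ab pk]
    have "path_mor D (Y k) (subdipath a b p) \<in> Mor (fc D (Y k) (Y k))"
      using m d_space_endpoints[OF d_space_dsub[OF X YX[OF k]] m] by (intro path_mor_in_Mor)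
    moreover have "snd (incl D X) (path_mor D (Y k) (subdipath a b p)) = path_mor D X (subdipath a b p)"
      by (rule incl_path_mor[OF YX[OF k] m])
    ultimately show "path_mor D X (subdipath a b p) \<in> ?G" using k by (intro gen_base) force
  next
    fix a b c :: real assume ab: "0 \<le> a" "a \<le> b" "b \<le> c" "c \<le> 1"
      and G: "path_mor D X (subdipath a b p) \<in> ?G" "path_mor D X (subdipath b c p) \<in> ?G"
    have m: "subdipath a b p \<in> dsub D X" "subdipath b c p \<in> dsub D X" using ab by (auto intro!: mem)
    have e: "subdipath a b p 1 = subdipath b c p 0" by (simp add: subdipath_def)
    have "path_mor D X (subdipath a c p) = path_mor D X (subdipath a b p +++ subdipath b c p)"
      using direl_subdipath_join[OF X p ab] by (intro path_mor_cong) (simp add: dsub_whole[OF X])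
    also have "\<dots> = Comp (fc D X X) (path_mor D X (subdipath b c p)) (path_mor D X (subdipath a b p))"
      using Comp_path_mor[OF X order_refl m e] by simp
    finally show "path_mor D X (subdipath a c p) \<in> ?G"
      using gen_comp[OF G] m e d_space_endpoints[OF X' m(1)] d_space_endpoints[OF X' m(2)]
      by (simp add: path_mor_in_Mor)
  qed auto
  thus "f \<in> ?G" using f by simp
qed

end

text \<open>Agreement of the functors is stated for dipaths that lie in two parts at once, without
  recourse to the fundamental category of the intersection.\<close>

locale d_cover_cocone = d_cover X D K Y
  for X :: "'a::topological_space set" and D :: "(real \<Rightarrow> 'a) set" and K :: "'k set" and Y +
  fixes E :: "('oe, 'me) cat" and F :: "'k \<Rightarrow> ('a, 'a dmor, 'oe, 'me) ftr"
  assumes E: "category E" and F: "\<And>k. k \<in> K \<Longrightarrow> is_functor (fc D (Y k) (Y k)) E (F k)"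
    and agree_obj: "\<And>k k' x. k \<in> K \<Longrightarrow> k' \<in> K \<Longrightarrow> x \<in> Y k \<Longrightarrow> x \<in> Y k' \<Longrightarrow> fst (F k) x = fst (F k') x"
    and agree_mor: "\<And>k k' p. k \<in> K \<Longrightarrow> k' \<in> K \<Longrightarrow> p \<in> dsub D (Y k) \<Longrightarrow> p \<in> dsub D (Y k') \<Longrightarrow>
      snd (F k) (path_mor D (Y k) p) = snd (F k') (path_mor D (Y k') p)"
begin

definition obj_val :: "'a \<Rightarrow> 'oe" where
  "obj_val x = fst (F (SOME k. k \<in> K \<and> x \<in> Y k)) x"

definition piece_val :: "'k \<Rightarrow> (real \<Rightarrow> 'a) \<Rightarrow> 'me" where
  "piece_val k p = snd (F k) (path_mor D (Y k) p)"

lemma obj_val_eq: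
  assumes "k \<in> K" "x \<in> Y k" shows "fst (F k) x = obj_val x"
proof -
  have "(SOME k. k \<in> K \<and> x \<in> Y k) \<in> K \<and> x \<in> Y (SOME k. k \<in> K \<and> x \<in> Y k)"
    by (rule someI[of _ k]) (use assms in auto)
  thus ?thesis unfolding obj_val_def using agree_obj assms by blast
qed

lemma Y_space: "k \<in> K \<Longrightarrow> d_space (Y k) (dsub D (Y k))"
  by (rule d_space_dsub[OF X YX])

lemma path_mor_hom:
  assumes "k \<in> K" "p \<in> dsub D (Y k)"
  shows "path_mor D (Y k) p \<in> hom (fc D (Y k) (Y k)) (p 0) (p 1)"
  using assms d_space_endpoints[OF Y_space[OF assms(1)] assms(2)]
  by (auto simp: hom_def intro!: path_mor_in_Mor)

lemma piece_val_hom: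
  assumes "k \<in> K" "p \<in> dsub D (Y k)"
  shows "piece_val k p \<in> hom E (obj_val (p 0)) (obj_val (p 1))"
  using functor_hom[OF F path_mor_hom[OF assms]] d_space_endpoints[OF Y_space[OF assms(1)] assms(2)] assms
  by (simp add: piece_val_def obj_val_eq)

lemma piece_val_join:
  assumes "k \<in> K" "p \<in> dsub D (Y k)" "q \<in> dsub D (Y k)" "p 1 = q 0"
  shows "piece_val k (p +++ q) = Comp E (piece_val k q) (piece_val k p)"
  using functor_comp[OF F path_mor_hom, of k p "path_mor D (Y k) q" "q 1"] path_mor_hom[of k q] assms
  by (simp add: piece_val_def Comp_path_mor[OF X YX])

lemma piece_val_cong: "(p, q) \<in> direl (Y k) (dsub D (Y k)) \<Longrightarrow> piece_val k p = piece_val k q"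
  by (simp add: piece_val_def path_mor_cong)

lemma piece_val_const:
  assumes "k \<in> K" "x \<in> Y k" shows "piece_val k (\<lambda>t. x) = Id E (obj_val x)"
  using functor_id[OF F, of k x] assms by (simp add: piece_val_def obj_val_eq)

text \<open>The splitting has to take place inside the part. Since \<open>p\<close> as a whole may
  leave it, \<open>direl_subdipath_join\<close> is applied to the restricted dipath
  \<open>?q\<close>.\<close>

lemma piece_val_subdipath_join:
  assumes k: "k \<in> K" and p: "p \<in> D" and ab: "0 \<le> a" "a \<le> b" "b \<le> c" "c \<le> 1" and pk: "p ` {a..c} \<subseteq> Y k"
  shows "piece_val k (subdipath a c p) = Comp E (piece_val k (subdipath b c p)) (piece_val k (subdipath a b p))"
proof -
  have sub: "p ` {a..b} \<subseteq> Y k" "p ` {b..c} \<subseteq> Y k" using pk ab by (auto simp: image_subset_iff)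
  let ?q = "subdipath a c p"
  have m: "subdipath a b p \<in> dsub D (Y k)" "subdipath b c p \<in> dsub D (Y k)" "?q \<in> dsub D (Y k)"
    using ab sub pk by (auto intro!: piece_mem[OF p])
  have e: "subdipath a b p 1 = subdipath b c p 0" by (simp add: subdipath_def)
  have "(?q, subdipath a b p +++ subdipath b c p) \<in> direl (Y k) (dsub D (Y k))"
  proof (cases "a = c")
    case True
    hence "b = a" using ab by simp
    hence "?q t = (subdipath a b p +++ subdipath b c p) t" for t using True
      by (simp add: subdipath_def joinpaths_def)
    hence "?q = subdipath a b p +++ subdipath b c p" by auto
    thus ?thesis using m(3) direl_refl by metis
  next
    case False
    \<comment> \<open>The relative position of \<open>b\<close> between \<open>a\<close> and
      \<open>c\<close>; the division is the reason for treating \<open>a = c\<close>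
      separately.\<close>
    define s where "s = (b - a) / (c - a)"
    have s: "0 \<le> s" "s \<le> 1" "(c - a) * s = b - a" using False ab by (auto simp: s_def field_simps)
    have "(subdipath 0 1 ?q, subdipath 0 s ?q +++ subdipath s 1 ?q) \<in> direl (Y k) (dsub D (Y k))"
      using s by (intro direl_subdipath_join[OF Y_space[OF k] m(3)]) auto
    moreover have "subdipath 0 s ?q = subdipath a b p" "subdipath s 1 ?q = subdipath b c p"
    proof -
      have 1: "(c - a) * ((s - 0) * t + 0) + a = (b - a) * t + a" for t
        using s(3) by (simp add: mult.assoc[symmetric])
      show "subdipath 0 s ?q = subdipath a b p" unfolding subdipath_def 1 ..
      have 2: "(c - a) * ((1 - s) * t + s) + a = (c - b) * t + b" for t
      proof -
        have "(c - a) * ((1 - s) * t + s) + a = (c - a) * t - (c - a) * s * t + (c - a) * s + a"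
          by (simp add: algebra_simps)
        also have "\<dots> = (c - b) * t + b" unfolding s(3) by (simp add: algebra_simps)
        finally show ?thesis .
      qed
      show "subdipath s 1 ?q = subdipath b c p" unfolding subdipath_def 2 ..
    qed
    ultimately show ?thesis by simp
  qed
  thus ?thesis using piece_val_join[OF k m(1,2) e] piece_val_cong by metis
qed

text \<open>\<open>val p a b m\<close> says that \<open>m\<close> is the composite of the pieces of some subdivision of \<open>[a, b]\<close>.
  Independence of the subdivision follows because every value can be split at any intermediate point.\<close>
inductive val :: "(real \<Rightarrow> 'a) \<Rightarrow> real \<Rightarrow> real \<Rightarrow> 'me \<Rightarrow> bool" for p where
  val_piece: "k \<in> K \<Longrightarrow> 0 \<le> a \<Longrightarrow> a \<le> b \<Longrightarrow> b \<le> 1 \<Longrightarrow> p ` {a..b} \<subseteq> Y k \<Longrightarrow> val p a b (piece_val k (subdipath a b p))"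
| val_join: "val p a b m \<Longrightarrow> val p b c m' \<Longrightarrow> val p a c (Comp E m' m)"

lemma val_hom:
  assumes "val p a b m" "p \<in> D"
  shows "0 \<le> a \<and> a \<le> b \<and> b \<le> 1 \<and> m \<in> hom E (obj_val (p a)) (obj_val (p b))"
  using assms
proof induction
  case (val_piece k a b)
  thus ?case using piece_val_hom[OF _ piece_mem, of k p a b] by (simp add: subdipath_def)
qed (auto intro: category_comp[OF E])

text \<open>A point inside a piece divides that piece. Otherwise it falls into one factor of a
  composite, and associativity regroups the three values.\<close>

lemma val_split:
  assumes "val p a c m" "p \<in> D" "a \<le> b" "b \<le> c"
  shows "\<exists>m1 m2. val p a b m1 \<and> val p b c m2 \<and> m = Comp E m2 m1"
  using assms
proof (induction arbitrary: b)
  case (val_piece k a c)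
  have "p ` {a..b} \<subseteq> Y k" "p ` {b..c} \<subseteq> Y k" using val_piece by (auto simp: image_subset_iff)
  thus ?case using val_piece piece_val_subdipath_join[of k p a b c] val.val_piece[of k a b p] val.val_piece[of k b c p] by auto
next
  case (val_join a d m c m')
  note h = val_hom[OF val_join.hyps(1) val_join.prems(1)] val_hom[OF val_join.hyps(2) val_join.prems(1)]
  show ?case
  proof (cases "b \<le> d")
    case True
    then obtain m1 m2 where *: "val p a b m1" "val p b d m2" "m = Comp E m2 m1" using val_join by blast
    have "Comp E m' m = Comp E (Comp E m' m2) m1"
      using category_assoc[OF E, of m1 _ _ m2 _ m'] val_hom[OF *(1)] val_hom[OF *(2)] h val_join.prems *(3) by blast
    thus ?thesis using * val.val_join[OF *(2) val_join.hyps(2)] by blast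
  next
    case False
    hence "d \<le> b" by simp
    then obtain m1 m2 where *: "val p d b m1" "val p b c m2" "m' = Comp E m2 m1" using val_join by blast
    have "Comp E m' m = Comp E m2 (Comp E m1 m)"
      using category_assoc[OF E, of m _ _ m1 _ m2] val_hom[OF *(1)] val_hom[OF *(2)] h val_join.prems *(3) by metis
    thus ?thesis using * val.val_join[OF val_join.hyps(1) *(1)] by blast
  qed
qed

text \<open>At the leaves of the derivation \<open>agree_mor\<close> compares the two parts; at
  composites the functor \<open>F k\<close> respects the splitting.\<close>

lemma val_piece_unique:
  assumes "val p a b m" "p \<in> D" "k \<in> K" "p ` {a..b} \<subseteq> Y k"
  shows "m = piece_val k (subdipath a b p)"
  using assms
proof induction
  case (val_piece k' a b)
  thus ?case unfolding piece_val_def by (intro agree_mor piece_mem)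
next
  case (val_join a b m c m')
  have ab: "0 \<le> a" "a \<le> b" "b \<le> c" "c \<le> 1"
    using val_hom[OF val_join.hyps(1) val_join.prems(1)] val_hom[OF val_join.hyps(2) val_join.prems(1)] by auto
  hence "p ` {a..b} \<subseteq> Y k" "p ` {b..c} \<subseteq> Y k" using val_join.prems by (auto simp: image_subset_iff)
  thus ?case using val_join piece_val_subdipath_join[OF _ _ ab, of k p] by simp
qed

text \<open>The second value is split at the break point of the first derivation, which avoids
  forming a common refinement.\<close>

lemma val_unique:
  assumes "val p a b m" "val p a b m'" "p \<in> D"
  shows "m = m'"
  using assms
proof (induction arbitrary: m')
  case (val_piece k a b)
  thus ?case using val_piece_unique[of p a b m' k] by auto
next
  case (val_join a b m c n)
  have ab: "a \<le> b" "b \<le> c"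
    using val_hom[OF val_join.hyps(1) val_join.prems(2)] val_hom[OF val_join.hyps(2) val_join.prems(2)] by auto
  obtain m1 m2 where "val p a b m1" "val p b c m2" "m' = Comp E m2 m1"
    using val_split[OF val_join.prems ab] by blast
  thus ?case using val_join by metis
qed

definition V :: "(real \<Rightarrow> 'a) \<Rightarrow> real \<Rightarrow> real \<Rightarrow> 'me" where
  "V p a b = (THE m. val p a b m)"

lemma V_eqI: "val p a b m \<Longrightarrow> p \<in> D \<Longrightarrow> V p a b = m"
  unfolding V_def using val_unique by blast

lemma V_val:
  assumes "p \<in> D" "0 \<le> a" "a \<le> b" "b \<le> 1" shows "val p a b (V p a b)"
proof -
  have "\<exists>m. val p a b m"
    using assms by (rule path_piece_induct) (auto intro: val_piece val_join)
  thus ?thesis using V_eqI assms(1) by blast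
qed

lemma V_hom: "p \<in> D \<Longrightarrow> 0 \<le> a \<Longrightarrow> a \<le> b \<Longrightarrow> b \<le> 1 \<Longrightarrow> V p a b \<in> hom E (obj_val (p a)) (obj_val (p b))"
  using val_hom[OF V_val] by blast

lemma V_join:
  "p \<in> D \<Longrightarrow> 0 \<le> a \<Longrightarrow> a \<le> b \<Longrightarrow> b \<le> c \<Longrightarrow> c \<le> 1 \<Longrightarrow> V p a c = Comp E (V p b c) (V p a b)"
  by (intro V_eqI val_join[of p a b _ c] V_val) auto

lemma V_piece:
  "p \<in> D \<Longrightarrow> k \<in> K \<Longrightarrow> 0 \<le> a \<Longrightarrow> a \<le> b \<Longrightarrow> b \<le> 1 \<Longrightarrow> p ` {a..b} \<subseteq> Y k \<Longrightarrow> V p a b = piece_val k (subdipath a b p)"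
  by (intro V_eqI val_piece) auto

text \<open>Subdivisions are carried over by an affine change of time. This serves to compute a
  concatenation on each half and to ignore the behaviour of paths outside the unit interval.\<close>

lemma val_affine:
  assumes "val p a b m" "p \<in> D" and r: "r \<in> D" and cd: "0 \<le> c" "0 \<le> d" "c + d \<le> 1"
    and rp: "\<And>x. x \<in> {0..1} \<Longrightarrow> r (c * x + d) = p x"
  shows "val r (c * a + d) (c * b + d) m"
  using assms(1,2)
proof induction
  case (val_piece k a b)
  let ?a = "c * a + d" and ?b = "c * b + d"
  have "c * b \<le> c" using cd val_piece mult_left_le[of b c] by auto
  hence ab: "0 \<le> ?a" "?a \<le> ?b" "?b \<le> 1" using val_piece cd by (auto intro!: mult_left_mono)
  have eq: "subdipath ?a ?b r t = subdipath a b p t" if t: "t \<in> {0..1}" for t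
  proof -
    have "(b - a) * t \<le> b - a" "0 \<le> (b - a) * t" using val_piece t mult_left_le[of t "b - a"] by auto
    hence "(b - a) * t + a \<in> {0..1}" using val_piece by auto
    from rp[OF this] show ?thesis by (simp add: subdipath_def algebra_simps)
  qed
  have "r ` {?a..?b} = subdipath ?a ?b r ` {0..1}" by (simp add: subdipath_image_interval[OF ab(2)])
  also have "\<dots> = subdipath a b p ` {0..1}" using eq by (rule image_cong[OF refl])
  also have "\<dots> \<subseteq> Y k" using val_piece by (simp add: subdipath_image_interval)
  finally have im: "r ` {?a..?b} \<subseteq> Y k" .
  have "piece_val k (subdipath ?a ?b r) = piece_val k (subdipath a b p)"
    unfolding piece_val_def
    using path_mor_eq_on[OF X YX[OF \<open>k \<in> K\<close>] piece_mem[OF r ab im] piece_mem[OF val_piece(6,2,3,4,5)] eq] by simp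
  thus ?case using val.val_piece[OF \<open>k \<in> K\<close> ab im] by simp
qed (auto intro: val_join)

lemma V_affine:
  assumes "p \<in> D" "r \<in> D" "0 \<le> c" "0 \<le> d" "c + d \<le> 1" "\<And>x. x \<in> {0..1} \<Longrightarrow> r (c * x + d) = p x"
  shows "V r d (c + d) = V p 0 1"
  using val_affine[OF V_val[of p 0 1] assms] assms by (intro V_eqI) auto

lemma V_cong:
  assumes "p \<in> D" "q \<in> D" "\<And>x. x \<in> {0..1} \<Longrightarrow> p x = q x" shows "V p 0 1 = V q 0 1"
  using V_affine[of q p 1 0] assms by simp

lemma V_const:
  assumes "x \<in> X" shows "V (\<lambda>t. x) 0 1 = Id E (obj_val x)"
proof -
  obtain k where k: "k \<in> K" "x \<in> Y k" using cover_mem assms by blast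
  show ?thesis
    using V_piece[OF d_space_const[OF X assms] k(1), of 0 1] k piece_val_const[OF k] by (simp add: image_subset_iff)
qed

section \<open>Commuting rectangles and invariance under directed homotopy\<close>

lemma paste_squares:
  assumes l: "l \<in> hom E x y" and t: "t1 \<in> hom E y y'" "t2 \<in> hom E y' y''"
    and b: "b1 \<in> hom E x x'" "b2 \<in> hom E x' x''" and m: "m \<in> hom E x' y'" and r: "r \<in> hom E x'' y''"
    and sq: "Comp E t1 l = Comp E m b1" "Comp E t2 m = Comp E r b2"
  shows "Comp E (Comp E t2 t1) l = Comp E r (Comp E b2 b1)"
proof -
  \<comment> \<open>The letters stand for the left, top, bottom, middle and right edges of two
    adjacent squares.\<close>
  have "Comp E (Comp E t2 t1) l = Comp E t2 (Comp E t1 l)" by (rule category_assoc[OF E l t, symmetric])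
  also have "\<dots> = Comp E (Comp E t2 m) b1" unfolding sq(1) by (rule category_assoc[OF E b(1) m t(2)])
  also have "\<dots> = Comp E r (Comp E b2 b1)" unfolding sq(2) by (rule category_assoc[OF E b r, symmetric])
  finally show ?thesis .
qed

lemma dsquare_edges:
  assumes "dsquare X D H" "c \<in> {0..1}"
  shows "(\<lambda>t. H (c, t)) \<in> D" "(\<lambda>s. H (s, c)) \<in> D"
proof -
  have "sq_dipath (\<lambda>t. (c, t))" "sq_dipath (\<lambda>s. (s, c))"
    using assms(2) by (auto intro!: sq_dipathI continuous_intros)
  hence "H \<circ> (\<lambda>t. (c, t)) \<in> D" "H \<circ> (\<lambda>s. (s, c)) \<in> D" using assms(1) by (auto simp: dsquare_def)
  thus "(\<lambda>t. H (c, t)) \<in> D" "(\<lambda>s. H (s, c)) \<in> D" by (simp_all add: o_def)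
qed

text \<open>The two ways around the boundary of a rectangle, from the corner \<open>(a, c)\<close>
  to the corner \<open>(b, d)\<close>.\<close>

definition commutes :: "(real \<times> real \<Rightarrow> 'a) \<Rightarrow> real \<Rightarrow> real \<Rightarrow> real \<Rightarrow> real \<Rightarrow> bool" where
  "commutes H a b c d \<longleftrightarrow> Comp E (V (\<lambda>s. H (s, d)) a b) (V (\<lambda>t. H (a, t)) c d) =
     Comp E (V (\<lambda>t. H (b, t)) c d) (V (\<lambda>s. H (s, c)) a b)"

lemma commutes_join_fst:
  assumes H: "dsquare X D H" and "0 \<le> a" "a \<le> b" "b \<le> b'" "b' \<le> 1" "0 \<le> c" "c \<le> d" "d \<le> 1"
    and "commutes H a b c d" "commutes H b b' c d"
  shows "commutes H a b' c d"
proof -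
  note e = dsquare_edges[OF H]
  have D: "(\<lambda>s. H (s, d)) \<in> D" "(\<lambda>s. H (s, c)) \<in> D" "(\<lambda>t. H (a, t)) \<in> D" "(\<lambda>t. H (b, t)) \<in> D" "(\<lambda>t. H (b', t)) \<in> D"
    using assms by (auto intro!: e)
  show ?thesis
    unfolding commutes_def
    unfolding V_join[OF D(1) assms(2-5)] V_join[OF D(2) assms(2-5)]
    using assms(2-8) by (intro paste_squares[OF V_hom[OF D(3)] V_hom[OF D(1)] V_hom[OF D(1)] V_hom[OF D(2)] V_hom[OF D(2)]
          V_hom[OF D(4)] V_hom[OF D(5)] assms(9)[unfolded commutes_def] assms(10)[unfolded commutes_def]]) auto
qed

lemma commutes_join_snd:
  assumes H: "dsquare X D H" and "0 \<le> c" "c \<le> d" "d \<le> d'" "d' \<le> 1" "0 \<le> a" "a \<le> b" "b \<le> 1"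
    and "commutes H a b c d" "commutes H a b d d'"
  shows "commutes H a b c d'"
proof -
  note e = dsquare_edges[OF H]
  have D: "(\<lambda>t. H (b, t)) \<in> D" "(\<lambda>t. H (a, t)) \<in> D" "(\<lambda>s. H (s, c)) \<in> D" "(\<lambda>s. H (s, d)) \<in> D" "(\<lambda>s. H (s, d')) \<in> D"
    using assms by (auto intro!: e)
  show ?thesis
    unfolding commutes_def
    unfolding V_join[OF D(1) assms(2-5)] V_join[OF D(2) assms(2-5)]
    \<comment> \<open>The two coordinates have exchanged their roles, so the equations are read from
      right to left.\<close>
    using assms(2-8) by (intro paste_squares[OF V_hom[OF D(3)] V_hom[OF D(1)] V_hom[OF D(1)] V_hom[OF D(2)] V_hom[OF D(2)]
          V_hom[OF D(4)] V_hom[OF D(5)] assms(9)[unfolded commutes_def, symmetric] assms(10)[unfolded commutes_def, symmetric], symmetric]) auto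
qed

text \<open>The two halves of the boundary are monotone paths in a square that lies in
  \<open>Y k\<close>, so they are equivalent already there and \<open>F k\<close> takes the same
  value on them.\<close>

lemma commutes_small:
  assumes H: "dsquare X D H" and k: "k \<in> K" and ab: "0 \<le> a" "a \<le> b" "b \<le> 1" and cd: "0 \<le> c" "c \<le> d" "d \<le> 1"
    and im: "H ` ({a..b} \<times> {c..d}) \<subseteq> Y k"
  shows "commutes H a b c d"
proof -
  define \<Phi> where "\<Phi> = (\<lambda>x::real \<times> real. ((b - a) * fst x + a, (d - c) * snd x + c))"
  define \<alpha> where "\<alpha> = (\<lambda>t::real. (0::real, t)) +++ (\<lambda>s. (s, 1))"
  define \<beta> where "\<beta> = (\<lambda>s::real. (s, 0::real)) +++ (\<lambda>t. (1, t))"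
  have aff: "(w - v) * t + v \<in> {v..w}" if "v \<le> w" "t \<in> {0..1}" for v w t :: real
    using that mult_left_le[of t "w - v"] by auto
  have range: "\<Phi> ` ({0..1} \<times> {0..1}) \<subseteq> {a..b} \<times> {c..d}"
    using aff[OF ab(2)] aff[OF cd(2)] unfolding \<Phi>_def by auto
  have "dsquare X D (H \<circ> \<Phi>)"
  proof (rule dsquare_comp[OF H])
    show "continuous_on ({0..1} \<times> {0..1}) \<Phi>" unfolding \<Phi>_def by (intro continuous_intros)
    have "{a..b} \<times> {c..d} \<subseteq> {0..1} \<times> {0..1}" using ab cd by auto
    thus "\<Phi> ` ({0..1} \<times> {0..1}) \<subseteq> {0..1} \<times> {0..1}" using range by (rule order_trans[rotated])
    show "fst (\<Phi> x) \<le> fst (\<Phi> y) \<and> snd (\<Phi> x) \<le> snd (\<Phi> y)" if "fst x \<le> fst y" "snd x \<le> snd y" for x y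
      using that ab cd unfolding \<Phi>_def by (simp add: mult_left_mono)
  qed
  moreover have imY: "(H \<circ> \<Phi>) ` ({0..1} \<times> {0..1}) \<subseteq> Y k"
  proof -
    have "(H \<circ> \<Phi>) ` ({0..1} \<times> {0..1}) = H ` \<Phi> ` ({0..1} \<times> {0..1})" by (simp add: image_comp)
    also have "\<dots> \<subseteq> Y k" using range im by (meson image_mono order_trans)
    finally show ?thesis .
  qed
  \<comment> \<open>The homotopies must run in \<open>Y k\<close> and not merely in
    \<open>X\<close>, since \<open>F k\<close> is only defined on classes formed in
    \<open>Y k\<close>.\<close>
  ultimately have "dsquare (Y k) (dsub D (Y k)) (H \<circ> \<Phi>)"
    unfolding dsquare_def dsub_def by (force simp: sq_dipath_def image_subset_iff)
  moreover have "sq_dipath \<alpha>" "sq_dipath \<beta>"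
    unfolding \<alpha>_def \<beta>_def by (auto intro!: sq_dipath_join sq_dipathI continuous_intros)
  ultimately have "(H \<circ> \<Phi> \<circ> \<alpha>, H \<circ> \<Phi> \<circ> \<beta>) \<in> direl (Y k) (dsub D (Y k))"
    by (rule dsquare_paths) (auto simp: \<alpha>_def \<beta>_def)
  moreover have "H \<circ> \<Phi> \<circ> \<alpha> = subdipath c d (\<lambda>t. H (a, t)) +++ subdipath a b (\<lambda>s. H (s, d))"
    "H \<circ> \<Phi> \<circ> \<beta> = subdipath a b (\<lambda>s. H (s, c)) +++ subdipath c d (\<lambda>t. H (b, t))"
    by (auto simp: \<alpha>_def \<beta>_def \<Phi>_def joinpaths_def subdipath_def)
  ultimately have eq: "piece_val k (subdipath c d (\<lambda>t. H (a, t)) +++ subdipath a b (\<lambda>s. H (s, d))) =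
      piece_val k (subdipath a b (\<lambda>s. H (s, c)) +++ subdipath c d (\<lambda>t. H (b, t)))"
    using piece_val_cong by metis
  have D: "(\<lambda>t. H (a, t)) \<in> D" "(\<lambda>s. H (s, d)) \<in> D" "(\<lambda>s. H (s, c)) \<in> D" "(\<lambda>t. H (b, t)) \<in> D"
    using ab cd by (auto intro!: dsquare_edges[OF H])
  have I: "(\<lambda>t. H (a, t)) ` {c..d} \<subseteq> Y k" "(\<lambda>s. H (s, d)) ` {a..b} \<subseteq> Y k"
    "(\<lambda>s. H (s, c)) ` {a..b} \<subseteq> Y k" "(\<lambda>t. H (b, t)) ` {c..d} \<subseteq> Y k"
    using im ab cd by auto
  have M: "subdipath c d (\<lambda>t. H (a, t)) \<in> dsub D (Y k)" "subdipath a b (\<lambda>s. H (s, d)) \<in> dsub D (Y k)"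
    "subdipath a b (\<lambda>s. H (s, c)) \<in> dsub D (Y k)" "subdipath c d (\<lambda>t. H (b, t)) \<in> dsub D (Y k)"
    using ab cd by (auto intro!: piece_mem D I)
  have J: "subdipath c d (\<lambda>t. H (a, t)) 1 = subdipath a b (\<lambda>s. H (s, d)) 0"
    "subdipath a b (\<lambda>s. H (s, c)) 1 = subdipath c d (\<lambda>t. H (b, t)) 0"
    by (simp_all add: subdipath_def)
  show ?thesis
    unfolding commutes_def V_piece[OF D(1) k cd I(1)] V_piece[OF D(2) k ab I(2)] V_piece[OF D(3) k ab I(3)] V_piece[OF D(4) k cd I(4)]
    using eq unfolding piece_val_join[OF k M(1,2) J(1)] piece_val_join[OF k M(3,4) J(2)] .
qed

text \<open>Two nested subdivision arguments, first along a vertical segment and then horizontally, replace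
  a grid of small rectangles.\<close>
lemma commutes_unit_square:
  assumes H: "dsquare X D H"
  shows "commutes H 0 1 0 1"
proof -
  have strip: "\<exists>e>0. \<forall>a b. 0 \<le> a \<and> a \<le> s \<and> s \<le> b \<and> b \<le> 1 \<and> b - a < e \<longrightarrow> commutes H a b 0 1"
    if s: "0 \<le> s" "s \<le> 1" for s
  proof -
    \<comment> \<open>\<open>e\<close> is a width in the homotopy variable that works for every thin
      strip around \<open>s\<close> over the segment from \<open>c\<close> to \<open>d\<close>. For
      adjacent segments the minimum of two widths works.\<close>
    define R where "R c d \<longleftrightarrow> (\<exists>e>0. \<forall>a b. 0 \<le> a \<and> a \<le> s \<and> s \<le> b \<and> b \<le> 1 \<and> b - a < e \<longrightarrow> commutes H a b c d)" for c d
    have "0 \<le> (0::real) \<longrightarrow> 1 \<le> (1::real) \<longrightarrow> R 0 1"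
    proof (induction rule: Bolzano[where P = "\<lambda>c d. 0 \<le> c \<longrightarrow> d \<le> 1 \<longrightarrow> R c d", OF zero_le_one])
      case (1 c d d')
      show ?case
      proof (intro impI)
        assume cd: "0 \<le> c" "d' \<le> 1"
        hence "R c d" "R d d'" using 1 by auto
        then obtain e1 e2 where e: "e1 > 0" "e2 > 0"
          "\<And>a b. 0 \<le> a \<and> a \<le> s \<and> s \<le> b \<and> b \<le> 1 \<and> b - a < e1 \<Longrightarrow> commutes H a b c d"
          "\<And>a b. 0 \<le> a \<and> a \<le> s \<and> s \<le> b \<and> b \<le> 1 \<and> b - a < e2 \<Longrightarrow> commutes H a b d d'"
          unfolding R_def by metis
        have "commutes H a b c d'" if "0 \<le> a \<and> a \<le> s \<and> s \<le> b \<and> b \<le> 1 \<and> b - a < min e1 e2" for a b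
          using that 1 cd e by (intro commutes_join_snd[OF H, of c d d']) auto
        thus "R c d'" unfolding R_def using e by (intro exI[of _ "min e1 e2"]) auto
      qed
    next
      case (2 t)
      have st: "(s, t) \<in> {0..1} \<times> {0..1}" using 2 s by auto
      obtain k e where k: "k \<in> K" "e > 0" "H ` (ball (s, t) e \<inter> {0..1} \<times> {0..1}) \<subseteq> Y k"
        using cover_local[OF _ _ st, of H] H unfolding dsquare_def by blast
      have "commutes H a b c d"
        if *: "c \<le> t \<and> t \<le> d \<and> d - c < e / 2" "0 \<le> c" "d \<le> 1" "0 \<le> a \<and> a \<le> s \<and> s \<le> b \<and> b \<le> 1 \<and> b - a < e / 2" for a b c d
      proof (rule commutes_small[OF H k(1)])
        have "{a..b} \<times> {c..d} \<subseteq> ball (s, t) e \<inter> {0..1} \<times> {0..1}"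
        proof clarify
          fix x y assume xy: "x \<in> {a..b}" "y \<in> {c..d}"
          \<comment> \<open>Each coordinate differs by less than \<open>e / 2\<close>, and the sum
            of the two differences bounds the distance.\<close>
          have "dist (s, t) (x, y) \<le> \<bar>s - x\<bar> + \<bar>t - y\<bar>"
            using sqrt_sum_squares_le_sum_abs[of "s - x" "t - y"] by (simp add: dist_Pair_Pair dist_real_def)
          also have "\<dots> < e" using * xy by auto
          finally show "(x, y) \<in> ball (s, t) e \<inter> {0..1} \<times> {0..1}" using * xy by auto
        qed
        thus "H ` ({a..b} \<times> {c..d}) \<subseteq> Y k" using k(3) by blast
      qed (use * in auto)
      thus ?case unfolding R_def using k(2)
        by (intro exI[of _ "e / 2"]) (auto intro!: exI[of _ "e / 2"])
    qed
    thus ?thesis by (simp add: R_def)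
  qed
  have "0 \<le> (0::real) \<longrightarrow> 1 \<le> (1::real) \<longrightarrow> commutes H 0 1 0 1"
  proof (induction rule: Bolzano[where P = "\<lambda>a b. 0 \<le> a \<longrightarrow> b \<le> 1 \<longrightarrow> commutes H a b 0 1", OF zero_le_one])
    case (1 a b c)
    thus ?case using commutes_join_fst[OF H, of a b c 0 1] by auto
  next
    case (2 s)
    show ?case using strip[OF 2] by blast
  qed
  thus ?thesis by simp
qed

text \<open>Endpoints are fixed, so the edges in the homotopy direction are constant and their
  values are identities. The commuting unit square then reduces to an equality between the other two
  edges.\<close>

lemma V_dihtpy:
  assumes p: "p \<in> D" and q: "q \<in> D" and "dihtpy X D p q"
  shows "V p 0 1 = V q 0 1"
proof -
  obtain H where H: "dsquare X D H" and pq: "\<And>t. t \<in> {0..1} \<Longrightarrow> H (0, t) = p t \<and> H (1, t) = q t"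
    and ends: "\<And>s. s \<in> {0..1} \<Longrightarrow> H (s, 0) = p 0 \<and> H (s, 1) = p 1"
    using assms(3) unfolding dihtpy_iff_dsquare by blast
  note e = dsquare_edges[OF H]
  have x: "p 0 \<in> X" "p 1 \<in> X" using d_space_endpoints[OF X p] .
  have q01: "q 0 = p 0" "q 1 = p 1" using dihtpy_endpoints[OF assms(3)] by auto
  have "V (\<lambda>t. H (0, t)) 0 1 = V p 0 1" "V (\<lambda>t. H (1, t)) 0 1 = V q 0 1"
    using p q pq by (auto intro!: V_cong e)
  moreover have "V (\<lambda>s. H (s, 0)) 0 1 = V (\<lambda>s. p 0) 0 1" "V (\<lambda>s. H (s, 1)) 0 1 = V (\<lambda>s. p 1) 0 1"
    using ends x by (auto intro!: V_cong e d_space_const[OF X])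
  ultimately have "Comp E (Id E (obj_val (p 1))) (V p 0 1) = Comp E (V q 0 1) (Id E (obj_val (p 0)))"
    using commutes_unit_square[OF H] unfolding commutes_def by (simp add: V_const x)
  thus ?thesis
    using category_id_left[OF E V_hom[OF p, of 0 1]] category_id_right[OF E V_hom[OF q, of 0 1]] q01 by simp
qed

lemma V_direl: "(p, q) \<in> direl X D \<Longrightarrow> V p 0 1 = V q 0 1"
  by (induction rule: direl_induct) (auto intro: V_dihtpy)

lemma V_join_paths:
  assumes "p \<in> D" "q \<in> D" "p 1 = q 0"
  shows "V (p +++ q) 0 1 = Comp E (V q 0 1) (V p 0 1)"
proof -
  have pq: "p +++ q \<in> D" by (rule d_space_join[OF X assms])
  have "V (p +++ q) 0 (1/2) = V p 0 1"
    using V_affine[OF assms(1) pq, of "1/2" 0] by (simp add: joinpaths_def)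
  \<comment> \<open>At time 1/2 the concatenation is evaluated through \<open>p\<close>, hence the
    use of \<open>p 1 = q 0\<close>.\<close>
  moreover have "V (p +++ q) (1/2) 1 = V q 0 1"
    using V_affine[OF assms(2) pq, of "1/2" "1/2"] assms(3) by (force simp: joinpaths_def)
  ultimately show ?thesis using V_join[OF pq, of 0 "1/2" 1] by simp
qed

section \<open>The induced functor and the pushout property\<close>

definition glued :: "('a, 'a dmor, 'oe, 'me) ftr" where
  "glued = (obj_val, \<lambda>f. V (rep (snd (snd f))) 0 1)"

lemma glued_path_mor: "p \<in> D \<Longrightarrow> snd glued (path_mor D X p) = V p 0 1"
  using V_direl[OF rep_dclass, of p] by (simp add: glued_def path_mor_def dsub_whole[OF X])

lemma functor_glued: "is_functor (fc D X X) E glued"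
  unfolding is_functor_def
proof (intro conjI ballI impI)
  fix x assume "x \<in> Obj (fc D X X)"
  hence x: "x \<in> X" by simp
  show "fst glued x \<in> Obj E"
    using category_dom[OF E V_hom[OF d_space_const[OF X x], of 0 1]] by (simp add: glued_def)
  show "snd glued (Id (fc D X X) x) = Id E (fst glued x)"
    using x by (simp add: glued_path_mor d_space_const[OF X] V_const) (simp add: glued_def)
next
  fix f assume "f \<in> Mor (fc D X X)"
  then obtain p where f: "f = path_mor D X p" and p: "p \<in> D" by (auto simp: Mor_fc dsub_def)
  show "snd glued f \<in> hom E (fst glued (Dom (fc D X X) f)) (fst glued (Cod (fc D X X) f))"
    using V_hom[OF p, of 0 1] by (simp add: f glued_path_mor[OF p]) (simp add: glued_def)
  fix g assume "g \<in> Mor (fc D X X)" and e: "Cod (fc D X X) f = Dom (fc D X X) g"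
  then obtain q where g: "g = path_mor D X q" and q: "q \<in> D" by (auto simp: Mor_fc dsub_def)
  show "snd glued (Comp (fc D X X) g f) = Comp E (snd glued g) (snd glued f)"
    using e p q by (simp add: f g Comp_path_mor[OF X order_refl] dsub_whole[OF X] glued_path_mor d_space_join[OF X] V_join_paths)
qed

lemma glued_incl:
  assumes k: "k \<in> K" shows "fun_eq_on (fc D (Y k) (Y k)) (glued \<circ>\<^sub>F incl D X) (F k)"
  unfolding fun_eq_on_def
proof (intro conjI ballI)
  fix x assume "x \<in> Obj (fc D (Y k) (Y k))"
  thus "fst (glued \<circ>\<^sub>F incl D X) x = fst (F k) x" using k by (simp add: glued_def obj_val_eq)
next
  fix f assume "f \<in> Mor (fc D (Y k) (Y k))"
  then obtain p where f: "f = path_mor D (Y k) p" and p: "p \<in> dsub D (Y k)" by (rule Mor_fcE)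
  hence pD: "p \<in> D" "p ` {0..1} \<subseteq> Y k" by (auto simp: dsub_def)
  show "snd (glued \<circ>\<^sub>F incl D X) f = snd (F k) f"
    using V_piece[OF pD(1) k _ _ _ pD(2)] incl_path_mor[OF YX[OF k] p]
    by (simp add: f glued_path_mor pD(1) piece_val_def)
qed

end

lemma fun_eq_on_gen:
  assumes H: "is_functor C E H" "is_functor C E H'" and S: "S \<subseteq> Mor C" "\<And>f. f \<in> S \<Longrightarrow> snd H f = snd H' f"
    and f: "f \<in> gen C S"
  shows "snd H f = snd H' f"
  using f
proof induction
  case (gen_comp f g)
  thus ?case using H by (simp add: is_functor_def)
qed (rule S(2))

text \<open>Existence is the functor \<open>glued\<close>. Uniqueness holds because the parts cover
  the objects and their morphisms generate.\<close>

theorem van_Kampen: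
  fixes X :: "'a::topological_space set"
  assumes X: "d_space X D" and sub: "X1 \<subseteq> X" "X2 \<subseteq> X"
    and cover: "X = (top_of_set X interior_of X1) \<union> (top_of_set X interior_of X2)"
  shows "is_pushout TYPE(('oe, 'me) cat) (fc D (X1 \<inter> X2) (X1 \<inter> X2)) (fc D X1 X1) (fc D X2 X2) (fc D X X)
           (incl D X1) (incl D X2) (incl D X) (incl D X)"
  unfolding is_pushout_def
proof (intro conjI allI impI)
  show "category (fc D (X1 \<inter> X2) (X1 \<inter> X2))" "category (fc D X1 X1)" "category (fc D X2 X2)" "category (fc D X X)"
    using sub by (auto intro!: category_fc[OF X])
  show "is_functor (fc D (X1 \<inter> X2) (X1 \<inter> X2)) (fc D X1 X1) (incl D X1)"
    "is_functor (fc D (X1 \<inter> X2) (X1 \<inter> X2)) (fc D X2 X2) (incl D X2)"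
    using sub by (auto intro!: functor_incl[OF X])
  show G: "is_functor (fc D X1 X1) (fc D X X) (incl D X)" "is_functor (fc D X2 X2) (fc D X X) (incl D X)"
    using sub by (auto intro!: functor_incl[OF X])
  show "fun_eq_on (fc D (X1 \<inter> X2) (X1 \<inter> X2)) (incl D X \<circ>\<^sub>F incl D X1) (incl D X \<circ>\<^sub>F incl D X2)"
    using sub incl_incl[of "X1 \<inter> X2" X1 X] incl_incl[of "X1 \<inter> X2" X2 X] by (simp add: fun_eq_on_def)
  fix E :: "('oe, 'me) cat" and H1 H2
  assume "category E \<and> is_functor (fc D X1 X1) E H1 \<and> is_functor (fc D X2 X2) E H2 \<and>
    fun_eq_on (fc D (X1 \<inter> X2) (X1 \<inter> X2)) (H1 \<circ>\<^sub>F incl D X1) (H2 \<circ>\<^sub>F incl D X2)"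
  hence E: "category E" and H12: "is_functor (fc D X1 X1) E H1" "is_functor (fc D X2 X2) E H2"
    and eq: "fun_eq_on (fc D (X1 \<inter> X2) (X1 \<inter> X2)) (H1 \<circ>\<^sub>F incl D X1) (H2 \<circ>\<^sub>F incl D X2)" by auto
  define Y where "Y = (\<lambda>k. if k then X1 else X2)"
  define F where "F = (\<lambda>k. if k then H1 else H2)"
  have eq_mor: "snd H1 (path_mor D X1 p) = snd H2 (path_mor D X2 p)" if p: "p \<in> dsub D X1" "p \<in> dsub D X2" for p
  proof -
    \<comment> \<open>A dipath in both parts is a dipath in the intersection, where agreement is the
      commutativity of the given cocone.\<close>
    have p0: "p \<in> dsub D (X1 \<inter> X2)" using p by (auto simp: dsub_def)
    hence "path_mor D (X1 \<inter> X2) p \<in> Mor (fc D (X1 \<inter> X2) (X1 \<inter> X2))"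
      by (intro path_mor_in_Mor) (auto simp: dsub_def)
    from fun_eq_onD(2)[OF eq this] show ?thesis
      by (simp add: incl_path_mor[OF Int_lower1 p0] incl_path_mor[OF Int_lower2 p0])
  qed
  interpret d_cover_cocone X D "UNIV :: bool set" Y E F
  proof
    show "X = (\<Union>k\<in>UNIV. top_of_set X interior_of Y k)" using cover by (auto simp: Y_def UNIV_bool)
    show "fst (F k) x = fst (F k') x" if "x \<in> Y k" "x \<in> Y k'" for k k' x
      using that fun_eq_onD(1)[OF eq] by (auto simp: Y_def F_def split: if_splits)
    show "snd (F k) (path_mor D (Y k) p) = snd (F k') (path_mor D (Y k') p)"
      if "p \<in> dsub D (Y k)" "p \<in> dsub D (Y k')" for k k' p
      using that eq_mor by (auto simp: Y_def F_def split: if_splits)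
  qed (use X sub E H12 in \<open>auto simp: Y_def F_def split: if_splits\<close>)
  have glued: "fun_eq_on (fc D X1 X1) (glued \<circ>\<^sub>F incl D X) H1" "fun_eq_on (fc D X2 X2) (glued \<circ>\<^sub>F incl D X) H2"
    using glued_incl[of True] glued_incl[of False] by (simp_all add: Y_def F_def)
  have "fun_eq_on (fc D X X) glued H'" if H': "is_functor (fc D X X) E H'"
    "fun_eq_on (fc D X1 X1) (H' \<circ>\<^sub>F incl D X) H1" "fun_eq_on (fc D X2 X2) (H' \<circ>\<^sub>F incl D X) H2" for H'
    unfolding fun_eq_on_def
  proof (intro conjI ballI)
    fix x assume "x \<in> Obj (fc D X X)"
    hence "x \<in> X1 \<or> x \<in> X2" using cover_mem[of x] by (auto simp: Y_def split: if_splits)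
    thus "fst glued x = fst H' x" using glued H'(2,3) by (auto simp: fun_eq_on_def)
  next
    fix f assume "f \<in> Mor (fc D X X)"
    hence f: "f \<in> gen (fc D X X) (\<Union>k\<in>UNIV. snd (incl D X) ` Mor (fc D (Y k) (Y k)))" (is "_ \<in> gen _ ?S")
      using gen_fc by blast
    have S: "s \<in> snd (incl D X) ` Mor (fc D X1 X1) \<or> s \<in> snd (incl D X) ` Mor (fc D X2 X2)" if "s \<in> ?S" for s
      using that by (auto simp: Y_def split: if_splits)
    show "snd glued f = snd H' f"
    proof (rule fun_eq_on_gen[OF functor_glued H'(1) _ _ f])
      have "snd (incl D X) ` Mor (fc D X1 X1) \<subseteq> Mor (fc D X X)" "snd (incl D X) ` Mor (fc D X2 X2) \<subseteq> Mor (fc D X X)"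
        using hom_Mor[OF functor_hom[OF G(1) Mor_hom]] hom_Mor[OF functor_hom[OF G(2) Mor_hom]] by auto
      thus "?S \<subseteq> Mor (fc D X X)" using S by (meson subsetD subsetI)
      show "snd glued s = snd H' s" if "s \<in> ?S" for s
        using S[OF that] glued H'(2,3) by (auto simp: fun_eq_on_def)
    qed
  qed
  thus "\<exists>H. is_functor (fc D X X) E H \<and> fun_eq_on (fc D X1 X1) (H \<circ>\<^sub>F incl D X) H1 \<and>
      fun_eq_on (fc D X2 X2) (H \<circ>\<^sub>F incl D X) H2 \<and>
      (\<forall>H'. is_functor (fc D X X) E H' \<and> fun_eq_on (fc D X1 X1) (H' \<circ>\<^sub>F incl D X) H1 \<and>
         fun_eq_on (fc D X2 X2) (H' \<circ>\<^sub>F incl D X) H2 \<longrightarrow> fun_eq_on (fc D X X) H H')"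
    using functor_glued glued by blast
qed

section \<open>Induction along the chain of retracts\<close>

lemma full_sub_fc: "A \<subseteq> B \<Longrightarrow> full_sub (fc D Y A) (fc D Y B)"
  unfolding full_sub_def fc_def fund_cat_def by auto

lemma retract_unit_Mor: "retract fut C B P u \<Longrightarrow> x \<in> Obj C \<Longrightarrow> u x \<in> Mor C"
  by (auto simp: retract_def future_retract_def past_retract_def hom_def split: if_splits)

theorem theorem4p8:
  fixes X :: "'a::topological_space set" and D :: "(real \<Rightarrow> 'a) set"
    and X1 X2 :: "'a set" and n :: nat
    and XX :: "nat \<Rightarrow> nat \<Rightarrow> 'a set"
    and P :: "nat \<Rightarrow> nat \<Rightarrow> ('a, 'a dmor, 'a, 'a dmor) ftr"
    and u :: "nat \<Rightarrow> nat \<Rightarrow> 'a \<Rightarrow> 'a dmor"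
    and fut :: "nat \<Rightarrow> bool"
  assumes dsp: "d_space X D"
    and sub: "X1 \<subseteq> X" "X2 \<subseteq> X"
    and cover: "X = (top_of_set X interior_of X1) \<union> (top_of_set X interior_of X2)"
    and concat: "\<forall>p\<in>D. \<exists>m (t :: nat \<Rightarrow> real). t 0 = 0 \<and> t m = 1 \<and> (\<forall>i<m. t i < t (Suc i)) \<and>
                   (\<forall>i<m. p ` {t i..t (Suc i)} \<subseteq> X1 \<or> p ` {t i..t (Suc i)} \<subseteq> X2)"
    and base: "XX 0 0 = X1 \<inter> X2" "XX 1 0 = X1" "XX 2 0 = X2"
    and decr: "\<forall>k\<le>2. \<forall>l\<in>{1..n}. XX k l \<subseteq> XX k (l - 1)"
    and inter: "\<forall>l\<in>{1..n}. XX 0 l = XX 1 l \<inter> XX 2 l"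
    and cover_l: "\<forall>l\<in>{1..n}. XX 1 l \<union> XX 2 l =
                     (top_of_set (XX 1 l \<union> XX 2 l) interior_of XX 1 l) \<union>
                     (top_of_set (XX 1 l \<union> XX 2 l) interior_of XX 2 l)"
    and retr: "\<forall>k\<le>2. \<forall>l\<in>{1..n}.
                 retract (fut l) (fc D (XX k 0) (XX k (l - 1))) (fc D (XX k 0) (XX k l)) (P k l) (u k l)"
    and commute: "\<forall>k\<in>{1, 2}. \<forall>l\<in>{1..n}.
                 fun_eq_on (fc D (XX 0 0) (XX 0 (l - 1)))
                   (P k l \<circ>\<^sub>F incl D (XX k 0)) (incl D (XX k 0) \<circ>\<^sub>F P 0 l)"
    and unit_compat: "\<forall>k\<in>{1, 2}. \<forall>l\<in>{1..n}. \<forall>x\<in>XX 0 (l - 1).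
                 snd (incl D (XX k 0)) (u 0 l x) = u k l x"
  shows "(\<forall>l\<le>n. is_pushout TYPE(('o, 'm) cat)
            (fc D (XX 0 0) (XX 0 l)) (fc D (XX 1 0) (XX 1 l)) (fc D (XX 2 0) (XX 2 l))
            (fc D X (XX 1 l \<union> XX 2 l))
            (incl D (XX 1 0)) (incl D (XX 2 0)) (incl D X) (incl D X)) \<and>
         (\<forall>l\<in>{1..n}. \<exists>Q.
            is_functor (fc D X (XX 1 (l - 1) \<union> XX 2 (l - 1))) (fc D X (XX 1 l \<union> XX 2 l)) Q \<and>
            (\<forall>k\<in>{1, 2}. fun_eq_on (fc D (XX k 0) (XX k (l - 1)))
                            (Q \<circ>\<^sub>F incl D X) (incl D X \<circ>\<^sub>F P k l)) \<and>
            (\<forall>Q'. is_functor (fc D X (XX 1 (l - 1) \<union> XX 2 (l - 1))) (fc D X (XX 1 l \<union> XX 2 l)) Q' \<and>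
                  (\<forall>k\<in>{1, 2}. fun_eq_on (fc D (XX k 0) (XX k (l - 1)))
                                  (Q' \<circ>\<^sub>F incl D X) (incl D X \<circ>\<^sub>F P k l))
                  \<longrightarrow> fun_eq_on (fc D X (XX 1 (l - 1) \<union> XX 2 (l - 1))) Q Q') \<and>
            (\<exists>v. retract (fut l) (fc D X (XX 1 (l - 1) \<union> XX 2 (l - 1))) (fc D X (XX 1 l \<union> XX 2 l)) Q v))"
proof -
  have mono0: "XX k l \<subseteq> XX k 0" if "k \<le> 2" "l \<le> n" for k l
    using that(2)
  proof (induction l)
    case (Suc l)
    have "XX k (Suc l) \<subseteq> XX k l" using decr that(1) Suc.prems by force
    thus ?case using Suc by auto
  qed simp
  have int: "XX 0 l = XX 1 l \<inter> XX 2 l" if "l \<le> n" for l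
    using that base inter by (cases l) auto
  have XX_X: "XX k 0 \<subseteq> X" if "k \<le> 2" for k
  proof -
    have "k = 0 \<or> k = 1 \<or> k = 2" using that by auto
    thus ?thesis using base sub by auto
  qed
  have XX0: "XX 0 0 \<subseteq> XX k 0" if "k \<in> {1, 2}" for k using that base by auto
  define CC where "CC k l = fc D (XX k 0) (XX k l)" for k l
  define CX where "CX l = fc D X (XX 1 l \<union> XX 2 l)" for l
  have XX_un: "XX 1 l \<union> XX 2 l \<subseteq> X" if "l \<le> n" for l
    using mono0[of 1 l] mono0[of 2 l] XX_X[of 1] XX_X[of 2] that by auto
  have catC: "category (CC k l)" if "k \<le> 2" "l \<le> n" for k l
    unfolding CC_def using that by (intro category_fc[OF dsp] XX_X mono0)
  have catX: "category (CX l)" if "l \<le> n" for l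
    unfolding CX_def using that by (intro category_fc[OF dsp] XX_un) auto
  have F: "is_functor (CC 0 l) (CC k l) (incl D (XX k 0))" if "k \<in> {1, 2}" "l \<le> n" for k l
    unfolding CC_def using that XX0 mono0[of 0 l] int[OF that(2)] by (intro functor_incl[OF dsp] XX_X) auto
  have G: "is_functor (CC k l) (CX l) (incl D X)" if "k \<in> {1, 2}" "l \<le> n" for k l
    unfolding CC_def CX_def using that mono0[of k l] XX_X[of k] by (intro functor_incl[OF dsp]) auto
  have subC: "full_sub (CC k l) (CC k (l - 1))" if "k \<le> 2" "l \<in> {1..n}" for k l
    unfolding CC_def using that decr by (intro full_sub_fc) auto
  have subX: "full_sub (CX l) (CX (l - 1))" if "l \<in> {1..n}" for l
  proof -
    have "XX 1 l \<subseteq> XX 1 (l - 1)" "XX 2 l \<subseteq> XX 2 (l - 1)" using decr that by auto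
    thus ?thesis unfolding CX_def by (intro full_sub_fc) blast
  qed
  have retr': "retract (fut l) (CC k (l - 1)) (CC k l) (P k l) (u k l)" if "k \<le> 2" "l \<in> {1..n}" for k l
    unfolding CC_def using retr that by blast
  have ret: "cat_retraction (CC k (l - 1)) (CC k l) (P k l)" if "k \<le> 2" "l \<in> {1..n}" for k l
    using that by (intro retract_cat_retraction[OF _ subC retr'] catC) auto
  have P_fun: "is_functor (CC k (l - 1)) (CC k l) (P k l)" if "k \<le> 2" "l \<in> {1..n}" for k l
    using ret[OF that] by (simp add: cat_retraction_def)
  have comm: "fun_eq_on (CC 0 (l - 1)) (P k l \<circ>\<^sub>F incl D (XX k 0)) (incl D (XX k 0) \<circ>\<^sub>F P 0 l)"
    if "k \<in> {1, 2}" "l \<in> {1..n}" for k l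
    unfolding CC_def using commute that by blast
  have ii: "snd (incl D X) (snd (incl D (XX k 0)) f) = snd (incl D X) f"
    if "k \<in> {1, 2}" "f \<in> Mor (CC 0 l)" for k l f
    using that XX0[OF that(1)] XX_X[of k] unfolding CC_def by (intro incl_incl[of "XX 0 0"]) auto

  let ?po = "\<lambda>l. is_pushout TYPE(('o, 'm) cat) (CC 0 l) (CC 1 l) (CC 2 l) (CX l) (incl D (XX 1 0)) (incl D (XX 2 0)) (incl D X) (incl D X)"
  \<comment> \<open>The same pushout with targets of the type of fundamental categories. The type
    variables of \<open>?po\<close> are fixed within the proof, and this instance is the one that
    yields functors into \<open>CX l\<close>.\<close>
  let ?poD = "\<lambda>l. is_pushout TYPE(('a, 'a dmor) cat) (CC 0 l) (CC 1 l) (CC 2 l) (CX l) (incl D (XX 1 0)) (incl D (XX 2 0)) (incl D X) (incl D X)"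
  let ?gen = "\<lambda>l. Mor (CX l) \<subseteq> gen (CX l) (\<Union>k\<in>{1, 2}. snd (incl D X) ` Mor (CC k l))"
  let ?good = "\<lambda>l Q. is_functor (CX (l - 1)) (CX l) Q \<and>
     (\<forall>k\<in>{1, 2}. fun_eq_on (CC k (l - 1)) (Q \<circ>\<^sub>F incl D X) (incl D X \<circ>\<^sub>F P k l))"

  have step: "\<exists>Q. ?good l Q \<and> (\<forall>Q'. ?good l Q' \<longrightarrow> fun_eq_on (CX (l - 1)) Q Q') \<and>
      (\<exists>v. retract (fut l) (CX (l - 1)) (CX l) Q v) \<and> ?gen l"
    if l: "l \<in> {1..n}" and po: "?poD (l - 1)" and gen: "?gen (l - 1)" for l
  proof -
    have ln: "l \<le> n" "l - 1 \<le> n" using l by auto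
    let ?H = "\<lambda>k. incl D X \<circ>\<^sub>F P k l"
    have H: "is_functor (CC k (l - 1)) (CX l) (?H k)" if "k \<in> {1, 2}" for k
      using that l ln by (intro functor_fcomp[OF P_fun G]) auto
    \<comment> \<open>On the overlap both functors factor through \<open>P 0 l\<close> by
      compatibility of the chains.\<close>
    have "fun_eq_on (CC 0 (l - 1)) (?H 1 \<circ>\<^sub>F incl D (XX 1 0)) (?H 2 \<circ>\<^sub>F incl D (XX 2 0))"
      unfolding fun_eq_on_def
    proof (intro conjI ballI)
      fix x assume "x \<in> Obj (CC 0 (l - 1))"
      thus "fst (?H 1 \<circ>\<^sub>F incl D (XX 1 0)) x = fst (?H 2 \<circ>\<^sub>F incl D (XX 2 0)) x"
        using fun_eq_onD(1)[OF comm[of 1 l], of x] fun_eq_onD(1)[OF comm[of 2 l], of x] l by simp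
    next
      fix f assume f: "f \<in> Mor (CC 0 (l - 1))"
      have "snd (P 0 l) f \<in> Mor (CC 0 l)"
        using functor_hom[OF P_fun[of 0 l] Mor_hom[OF f]] l by (auto simp: hom_def)
      thus "snd (?H 1 \<circ>\<^sub>F incl D (XX 1 0)) f = snd (?H 2 \<circ>\<^sub>F incl D (XX 2 0)) f"
        using fun_eq_onD(2)[OF comm[of 1 l] f] fun_eq_onD(2)[OF comm[of 2 l] f] l ii[of 1 _ l] ii[of 2 _ l] by simp
    qed
    with po catX[OF ln(1)] H[of 1] H[of 2] obtain Q where Q: "is_functor (CX (l - 1)) (CX l) Q"
      "fun_eq_on (CC 1 (l - 1)) (Q \<circ>\<^sub>F incl D X) (?H 1)" "fun_eq_on (CC 2 (l - 1)) (Q \<circ>\<^sub>F incl D X) (?H 2)"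
      and uniq: "\<And>Q'. is_functor (CX (l - 1)) (CX l) Q' \<Longrightarrow> fun_eq_on (CC 1 (l - 1)) (Q' \<circ>\<^sub>F incl D X) (?H 1) \<Longrightarrow>
        fun_eq_on (CC 2 (l - 1)) (Q' \<circ>\<^sub>F incl D X) (?H 2) \<Longrightarrow> fun_eq_on (CX (l - 1)) Q Q'"
      by (elim pushout_universal) auto
    have good: "?good l Q" using Q by simp
    interpret cocone "{1, 2::nat}" "\<lambda>k. CC k (l - 1)" "\<lambda>k. CC k l" "CX (l - 1)" "CX l" "\<lambda>k. incl D X" "\<lambda>k. P k l" Q
    proof
      show "Obj (CX (l - 1)) = (\<Union>k\<in>{1, 2}. Obj (CC k (l - 1)))" "Obj (CX l) = (\<Union>k\<in>{1, 2}. Obj (CC k l))"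
        by (auto simp: CX_def CC_def)
    qed (use l ln gen good catC catX subC subX G in auto)
    have v: "\<exists>v. retract (fut l) (CX (l - 1)) (CX l) Q v"
    proof (rule retract_glue)
      show "retract (fut l) (CC k (l - 1)) (CC k l) (P k l) (u k l)" if "k \<in> {1, 2}" for k
        using that l by (intro retr') auto
      show "snd (incl D X) (u k l x) = snd (incl D X) (u k' l x)"
        if k: "k \<in> {1, 2}" "k' \<in> {1, 2}" and x: "x \<in> Obj (CC k (l - 1))" "x \<in> Obj (CC k' (l - 1))" for k k' x
      proof (cases "k = k'")
        case False
        \<comment> \<open>Distinct indices put \<open>x\<close> into the overlap, where both units
          are images of the unit of \<open>P 0 l\<close>.\<close>
        hence x0: "x \<in> XX 0 (l - 1)" using k x int[OF ln(2)] by (auto simp: CC_def)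
        hence "u 0 l x \<in> Mor (CC 0 (l - 1))" using retract_unit_Mor[OF retr'[of 0 l]] l by (simp add: CC_def)
        hence "snd (incl D X) (snd (incl D (XX k 0)) (u 0 l x)) = snd (incl D X) (snd (incl D (XX k' 0)) (u 0 l x))"
          using ii[OF k(1)] ii[OF k(2)] by simp
        moreover have "snd (incl D (XX k 0)) (u 0 l x) = u k l x" "snd (incl D (XX k' 0)) (u 0 l x) = u k' l x"
          using unit_compat k l x0 by blast+
        ultimately show ?thesis by simp
      qed simp
    qed
    \<comment> \<open>The unit just found makes \<open>Q\<close> a retraction, and this is what lets
      generation pass to level \<open>l\<close>.\<close>
    hence "cat_retraction (CX (l - 1)) (CX l) Q" using retract_cat_retraction[OF catX[OF ln(2)] subX[OF l]] by blast
    hence "?gen l" by (rule gen_B) (use P_fun l in auto)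
    thus ?thesis using good uniq v by blast
  qed

  \<comment> \<open>All four corners now have compatible retractions, so both pushout statements
    move from level \<open>l - 1\<close> to level \<open>l\<close>.\<close>
  have po_step: "?po l \<and> ?poD l"
    if l: "l \<in> {1..n}" and po: "?po (l - 1)" "?poD (l - 1)" and Q: "?good l Q" "retract (fut l) (CX (l - 1)) (CX l) Q v" for l Q v
  proof -
    have "cat_retraction (CX (l - 1)) (CX l) Q" using l by (intro retract_cat_retraction[OF _ subX Q(2)] catX) auto
    note R = ret[OF _ l, of 0] ret[OF _ l, of 1] ret[OF _ l, of 2] this
    have ln: "l \<le> n" using l by simp
    note B = catC[OF _ ln, of 0] catC[OF _ ln, of 1] catC[OF _ ln, of 2] catX[OF ln]
      F[OF _ ln, of 1] F[OF _ ln, of 2] G[OF _ ln, of 1] G[OF _ ln, of 2]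
    have QG: "fun_eq_on (CC 1 (l - 1)) (Q \<circ>\<^sub>F incl D X) (incl D X \<circ>\<^sub>F P 1 l)"
      "fun_eq_on (CC 2 (l - 1)) (Q \<circ>\<^sub>F incl D X) (incl D X \<circ>\<^sub>F P 2 l)" using Q(1) by simp_all
    show ?thesis
      using pushout_retract[OF po(1) B R comm[OF _ l, of 1] comm[OF _ l, of 2] QG]
        pushout_retract[OF po(2) B R comm[OF _ l, of 1] comm[OF _ l, of 2] QG] by simp
  qed

  have all: "?po l \<and> ?poD l \<and> ?gen l" if "l \<le> n" for l
    using that
  proof (induction l)
    case 0
    have C0: "CC 0 0 = fc D (X1 \<inter> X2) (X1 \<inter> X2)" "CC 1 0 = fc D X1 X1" "CC 2 0 = fc D X2 X2"
      using base by (simp_all add: CC_def)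
    have "X1 \<union> X2 = X"
      using sub cover interior_of_subset[of "top_of_set X" X1] interior_of_subset[of "top_of_set X" X2] by blast
    hence CX0: "CX 0 = fc D X X" using base by (simp add: CX_def)
    interpret dc: d_cover X D "{1, 2::nat}" "\<lambda>k. XX k 0"
      using dsp sub cover base by unfold_locales auto
    have "?gen 0" using dc.gen_fc unfolding CX0 CC_def .
    thus ?case
      unfolding C0 CX0 base by (intro conjI van_Kampen[OF dsp sub cover])
  next
    case (Suc l)
    \<comment> \<open>Written with \<open>Suc l - 1\<close> to match the shape of
      \<open>step\<close> and \<open>po_step\<close>.\<close>
    hence IH: "?po (Suc l - 1)" "?poD (Suc l - 1)" "?gen (Suc l - 1)" and l: "Suc l \<in> {1..n}" by simp_all
    show ?case using step[OF l IH(2,3)] po_step[OF l IH(1,2)] by blast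
  qed
  show ?thesis
    unfolding CC_def[symmetric] CX_def[symmetric]
  proof (intro conjI ballI allI impI)
    show "?po l" if "l \<le> n" for l using all[OF that] by blast
    fix l assume l: "l \<in> {1..n}"
    hence "l - 1 \<le> n" by auto
    hence "?poD (l - 1)" "?gen (l - 1)" using all by blast+
    from step[OF l this] show "\<exists>Q. is_functor (CX (l - 1)) (CX l) Q \<and>
        (\<forall>k\<in>{1, 2}. fun_eq_on (CC k (l - 1)) (Q \<circ>\<^sub>F incl D X) (incl D X \<circ>\<^sub>F P k l)) \<and>
        (\<forall>Q'. ?good l Q' \<longrightarrow> fun_eq_on (CX (l - 1)) Q Q') \<and>
        (\<exists>v. retract (fut l) (CX (l - 1)) (CX l) Q v)" by blast
  qed
qed

end
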